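(* Consider triples $(\pi_1,V^{\pi_1},\check R_1)$ where $\check R_1$ is a symmetric Yang--Baxter operator on $V^{\pi_1}$. The relation "there exists an invertible $(\check R_1,\check R_2)$ intertwiner" between $(\pi_1,V^{\pi_1},\check R_1)$ and $(\pi_2,V^{\pi_2},\check R_2)$ is an equivalence relation on such triples. Moreover, among equivalent triples, with an invertible $(\check R_1,\check R_2)$ intertwiner $C$, the relation $$\overline{\operatorname{tr}}_{V^{\pi_1}}\check R_1(z)*_{\pi_1}\overline{\operatorname{tr}}_{V^{\pi}}C=\overline{\operatorname{tr}}_{V^{\pi}}C*_{\pi_2}\overline{\operatorname{tr}}_{V^{\pi_2}}\check R_2(z)$$ holds, i.e. for all $a\in\mathrm{Ob}(\pi_1)$, $b\in\mathrm{Ob}(\pi_2)$, $$\sum_{(\alpha',\beta')}\big(\overline{\operatorname{tr}}_{V^\pi}C\big)(\beta')\circ\big(\overline{\operatorname{tr}}_{V^{\pi_1}}\check R_1(z)\big)(\alpha')=\sum_{(\beta'',\gamma')}\big(\overline{\operatorname{tr}}_{V^{\pi_2}}\check R_2(z)\big)(\gamma')\circ\big(\overline{\operatorname{tr}}_{V^\pi}C\big)(\beta'')$$ as maps $\bigoplus_{\alpha\in\pi_1(a,a)}V^{\pi_1}_\alpha\to\bigoplus_{\gamma\in\pi_2(b,b)}V^{\pi_2}_\gamma$, where the left sum is over $\alpha'\in\pi_1,\beta'\in\pi$ with $s(\alpha')=a$, $t(\alpha')=s_\pi(\beta')$, $t_\pi(\beta')=b$, and the right sum over $\beta''\in\pi,\gamma'\in\pi_2$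 with $s_\pi(\beta'')=a$, $t_\pi(\beta'')=s(\gamma')$, $t(\gamma')=b$.
   Context: The ground field is $k=\mathbb C$. In a groupoid $\pi$, $\eta\circ\gamma$ means $\gamma$ followed by $\eta$; $s,t$ are source and target; $\pi(a,b)$ is the set of arrows from $a$ to $b$. A $\pi$-graded vector space of finite type is a family $V=(V_\alpha)_{\alpha\in\pi}$ of finite dimensional spaces indexed by the arrows such that for each object $a$ only finitely many arrows $\alpha$ with source or target $a$ have $V_\alpha\neq0$; $(V\otimes W)_\gamma=\bigoplus_{\beta\circ\alpha=\gamma}V_\alpha\otimes W_\beta$, and $\operatorname{End}(V\otimes V)$ consists of degree-preserving linear maps. A Yang--Baxter operator on $V$ is a meromorphic function $z\mapsto\check R(z)\in\operatorname{End}(V\otimes V)$ with $\check R(z-w)^{(23)}\check R(z)^{(12)}\check R(w)^{(23)}=\check R(w)^{(12)}\check R(z)^{(23)}\check R(z-w)^{(12)}$ and $\check R(z)\check R(-z)=\mathrm{id}$. Superscripts $(i\,i{+}1)$ indicate the tensor factors acted on. All graded spaces $V^{\pi_i}$ considered here are of finite type, have components of dimension at most one, satisfy $V^{\pi_i}_\alpha\ne0$ iff $V^{\pi_i}_{\alpha^{-1}}\neq0$, and come with a fixed basis vector $e_\alpha$ of each nonzero component. If $\check R(z)(e_\alpha\otimes e_\beta)=\sum_{\gamma,\delta} R_{\alpha\beta}^{\gamma\delta}(z)e_\gamma\otimes e_\delta$, the transpose is defined by $\check R^T(z)(e_{\delta^{-1}}\otimes e_{\gamma^{-1}})=\sum_{\alpha,\beta}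 R_{\alpha\beta}^{\gamma\delta}(z)\,e_{\beta^{-1}}\otimes e_{\alpha^{-1}}$; $\check R$ is symmetric if $\check R^T(z)=\check R(z)$. A connecting set from $\pi_1$ to $\pi_2$ is a set $\pi$ with surjective maps $s_\pi:\pi\to\mathrm{Ob}(\pi_1)$, $t_\pi:\pi\to\mathrm{Ob}(\pi_2)$, with finitely many elements of any given source or target; $V^\pi=\bigoplus_{\beta\in\pi}V^\pi_\beta$ with each $V^\pi_\beta$ one dimensional. Tensor products are direct sums over composable strings of arrows (e.g. $V^{\pi_1}\otimes V^\pi=\bigoplus_{t(\alpha)=s_\pi(\beta)}V^{\pi_1}_\alpha\otimes V^\pi_\beta$), and $\operatorname{Hom}$ denotes linear maps preserving source and target of strings. An $(\check R_1,\check R_2)$ intertwiner is a $C\in\operatorname{Hom}(V^{\pi_1}\otimes V^{\pi},V^{\pi}\otimes V^{\pi_2})$, for some connecting set $\pi$ from $\pi_1$ to $\pi_2$ and some space $V^\pi=\bigoplus_{\beta\in\pi}V^\pi_\beta$ with each $V^\pi_\beta$ one dimensional, with $C^{(12)}C^{(23)}\check R_1(z)^{(12)}=\check R_2(z)^{(23)}C^{(12)}C^{(23)}$ on $V^{\pi_1}\otimes V^{\pi_1}\otimes V^\pi$ for all $z$. It is invertible if there is $C^{-1}\in\operatorname{Hom}(V^\pi\otimes V^{\pi_2},V^{\pi_1}\otimes V^\pi)$ with $C^{-1}C=\mathrm{id}$ and $CC^{-1}=\mathrm{id}$. Partial traces: for $\beta\in\pi$ with $s_\pi(\beta)=a$,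 $t_\pi(\beta)=b$, $\alpha\in\pi_1(a,a)$, $\gamma\in\pi_2(b,b)$, let $C(\beta,\alpha,\gamma):V^{\pi_1}_\alpha\otimes V^\pi_\beta\to V^\pi_\beta\otimes V^{\pi_2}_\gamma$ be the corresponding component of $C$. With a basis $(e_{i,\beta})$ of $V^\pi_\beta$ and dual basis $(e^*_{i,\beta})$, $(\overline{\operatorname{tr}}_{V^\pi}C)(\beta):\bigoplus_{\alpha\in\pi_1(a,a)}V^{\pi_1}_\alpha\to\bigoplus_{\gamma\in\pi_2(b,b)}V^{\pi_2}_\gamma$ has components $\sum_i(e^*_{i,\beta}\otimes\mathrm{id})\,C(\beta,\alpha,\gamma)\,(\mathrm{id}\otimes e_{i,\beta})$. The partial traces $(\overline{\operatorname{tr}}_{V^{\pi_i}}\check R_i(z))(\alpha')$, $\alpha'\in\pi_i(a,a')$, are defined in the same way from the components $V^{\pi_i}_{\alpha}\otimes V^{\pi_i}_{\alpha'}\to V^{\pi_i}_{\alpha'}\otimes V^{\pi_i}_{\alpha''}$ of $\check R_i(z)$ ($\alpha\in\pi_i(a,a)$, $\alpha''\in\pi_i(a',a')$), tracing over $V^{\pi_i}_{\alpha'}$. *)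

theory Defs
  imports "HOL-Complex_Analysis.Complex_Analysis" "HOL-Library.Groups_Big_Fun"
begin

section \<open>Groupoids\<close>

record ('o, 'a) groupoid =
  Ob :: "'o set"
  Arr :: "'a set"
  Src :: "'a \<Rightarrow> 'o"
  Tgt :: "'a \<Rightarrow> 'o"
  Comp :: "'a \<Rightarrow> 'a \<Rightarrow> 'a"  \<comment> \<open>\<open>Comp G \<eta> \<gamma>\<close> is \<open>\<eta> \<circ> \<gamma>\<close>: first \<open>\<gamma>\<close>, then \<open>\<eta>\<close>\<close>
  Idt :: "'o \<Rightarrow> 'a"
  Inv :: "'a \<Rightarrow> 'a"

locale is_groupoid =
  fixes G :: "('o, 'a) groupoid"
  assumes Src_Ob: "\<gamma> \<in> Arr G \<Longrightarrow> Src G \<gamma> \<in> Ob G"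
    and Tgt_Ob: "\<gamma> \<in> Arr G \<Longrightarrow> Tgt G \<gamma> \<in> Ob G"
    and Comp_Arr: "\<gamma> \<in> Arr G \<Longrightarrow> \<eta> \<in> Arr G \<Longrightarrow> Tgt G \<gamma> = Src G \<eta> \<Longrightarrow>
      Comp G \<eta> \<gamma> \<in> Arr G \<and> Src G (Comp G \<eta> \<gamma>) = Src G \<gamma> \<and> Tgt G (Comp G \<eta> \<gamma>) = Tgt G \<eta>"
    and Comp_assoc: "\<gamma> \<in> Arr G \<Longrightarrow> \<eta> \<in> Arr G \<Longrightarrow> \<theta> \<in> Arr G \<Longrightarrow>
      Tgt G \<gamma> = Src G \<eta> \<Longrightarrow> Tgt G \<eta> = Src G \<theta> \<Longrightarrow>
      Comp G \<theta> (Comp G \<eta> \<gamma>) = Comp G (Comp G \<theta> \<eta>) \<gamma>"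
    and Idt_Arr: "a \<in> Ob G \<Longrightarrow> Idt G a \<in> Arr G \<and> Src G (Idt G a) = a \<and> Tgt G (Idt G a) = a"
    and Comp_Idt: "\<gamma> \<in> Arr G \<Longrightarrow>
      Comp G \<gamma> (Idt G (Src G \<gamma>)) = \<gamma> \<and> Comp G (Idt G (Tgt G \<gamma>)) \<gamma> = \<gamma>"
    and Inv_Arr: "\<gamma> \<in> Arr G \<Longrightarrow>
      Inv G \<gamma> \<in> Arr G \<and> Src G (Inv G \<gamma>) = Tgt G \<gamma> \<and> Tgt G (Inv G \<gamma>) = Src G \<gamma>"
    and Comp_Inv: "\<gamma> \<in> Arr G \<Longrightarrow>
      Comp G (Inv G \<gamma>) \<gamma> = Idt G (Src G \<gamma>) \<and> Comp G \<gamma> (Inv G \<gamma>) = Idt G (Tgt G \<gamma>)"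


section \<open>Direct sums of lines with source and target, and maps between them\<close>

text \<open>
  A space \<open>V = \<Oplus>\<^sub>x V\<^sub>x\<close> whose components are lines with chosen basis vectors \<open>e\<^sub>x\<close>, where each index
  \<open>x\<close> has a source and a target, is given by its index set together with the source and target
  maps. This covers \<open>V\<^sup>\<pi>\<^sup>i\<close> (index set: the arrows with nonzero component), \<open>V\<^sup>\<pi>\<close> for a connecting
  set \<open>\<pi>\<close>, and all tensor products of these (index set: the composable strings).
\<close>

record ('s, 't, 'x) lines =
  idx :: "'x set"
  src :: "'x \<Rightarrow> 's"
  tgt :: "'x \<Rightarrow> 't"

definition tensor ::
    "('s, 't, 'x) lines \<Rightarrow> ('t, 'u, 'y) lines \<Rightarrow> ('s, 'u, 'x \<times> 'y) lines"  (infixr \<open>\<otimes>\<close> 70) where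
  "V \<otimes> W = \<lparr> idx = {(x, y). x \<in> idx V \<and> y \<in> idx W \<and> tgt V x = src W y},
             src = (\<lambda>(x, y). src V x), tgt = (\<lambda>(x, y). tgt W y) \<rparr>"

definition paths :: "('s, 't, 'x) lines \<Rightarrow> 's \<Rightarrow> 't \<Rightarrow> 'x set" where
  "paths V a b = {x \<in> idx V. src V x = a \<and> tgt V x = b}"

text \<open>
  Linear maps are given by their matrices: \<open>M p q\<close> is the coefficient of \<open>e\<^sub>q\<close> in \<open>M(e\<^sub>p)\<close>, and it
  is 0 unless \<open>p\<close> and \<open>q\<close> are indices of the domain and of the codomain. In all uses below, a
  given \<open>p\<close> is connected to only finitely many \<open>q\<close> of the same source and target, so a matrix
  in \<open>Hom V W\<close> is the same thing as a linear map preserving sources and targets, and the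
  \<open>Sum_any\<close> in the composition has only finitely many nonzero terms.
\<close>

type_synonym ('x, 'y) mat = "'x \<Rightarrow> 'y \<Rightarrow> complex"

definition Hom :: "('s, 't, 'x) lines \<Rightarrow> ('s, 't, 'y) lines \<Rightarrow> ('x, 'y) mat set" where
  "Hom V W = {M. \<forall>p q. M p q \<noteq> 0 \<longrightarrow>
     p \<in> idx V \<and> q \<in> idx W \<and> src V p = src W q \<and> tgt V p = tgt W q}"

definition mcomp :: "('y, 'z) mat \<Rightarrow> ('x, 'y) mat \<Rightarrow> ('x, 'z) mat"  (infixr \<open>\<odot>\<close> 75) where
  "(N \<odot> M) p q = Sum_any (\<lambda>j. M p j * N j q)"

definition mid :: "('s, 't, 'x) lines \<Rightarrow> ('x, 'x) mat" where
  "mid V p q = (if p = q \<and> p \<in> idx V then 1 else 0)"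

text \<open>
  \<open>M\<^sup>(\<^sup>1\<^sup>2\<^sup>)\<close> and \<open>M\<^sup>(\<^sup>2\<^sup>3\<^sup>)\<close>. Composability of the strings is not tested here; since \<open>M\<close> preserves sources
  and targets, both map composable strings to combinations of composable strings.
\<close>

definition on12 :: "('x \<times> 'y, 'x' \<times> 'y') mat \<Rightarrow> ('x \<times> 'y \<times> 'z, 'x' \<times> 'y' \<times> 'z) mat" where
  "on12 M = (\<lambda>(x, y, z) (x', y', z'). if z = z' then M (x, y) (x', y') else 0)"

definition on23 :: "('y \<times> 'z, 'y' \<times> 'z') mat \<Rightarrow> ('x \<times> 'y \<times> 'z, 'x \<times> 'y' \<times> 'z') mat" where
  "on23 M = (\<lambda>(x, y, z) (x', y', z'). if x = x' then M (y, z) (y', z') else 0)"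


section \<open>Symmetric Yang--Baxter operators\<close>

text \<open>
  A triple \<open>(\<pi>, V\<^sup>\<pi>, R)\<close>: the groupoid, the set of arrows \<open>\<alpha>\<close> with \<open>V\<^sub>\<alpha> \<noteq> 0\<close> (each such \<open>V\<^sub>\<alpha>\<close> being the
  line spanned by \<open>e\<^sub>\<alpha>\<close>), and the operator, with \<open>R z (\<alpha>, \<beta>) (\<gamma>, \<delta>)\<close> standing for
  \<open>R\<^sub>\<alpha>\<^sub>\<beta>\<^sup>\<gamma>\<^sup>\<delta>(z)\<close>.
\<close>

record ('o, 'a) triple =
  gpd :: "('o, 'a) groupoid"
  supp :: "'a set"
  rmat :: "complex \<Rightarrow> ('a \<times> 'a, 'a \<times> 'a) mat"

definition space_of :: "('o, 'a) triple \<Rightarrow> ('o, 'o, 'a) lines" where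
  "space_of T = \<lparr> idx = supp T, src = Src (gpd T), tgt = Tgt (gpd T) \<rparr>"

definition finite_type_space :: "('o, 'a) triple \<Rightarrow> bool" where
  "finite_type_space T \<longleftrightarrow>
     supp T \<subseteq> Arr (gpd T) \<and>
     (\<forall>a \<in> Ob (gpd T). finite {\<alpha> \<in> supp T. Src (gpd T) \<alpha> = a \<or> Tgt (gpd T) \<alpha> = a}) \<and>
     (\<forall>\<alpha> \<in> Arr (gpd T). \<alpha> \<in> supp T \<longleftrightarrow> Inv (gpd T) \<alpha> \<in> supp T)"

definition graded_End :: "('o, 'a) triple \<Rightarrow> ('a \<times> 'a, 'a \<times> 'a) mat set" where
  "graded_End T = {M \<in> Hom (space_of T \<otimes> space_of T) (space_of T \<otimes> space_of T).
     \<forall>\<alpha> \<beta> \<gamma> \<delta>. M (\<alpha>, \<beta>) (\<gamma>, \<delta>) \<noteq> 0 \<longrightarrow> Comp (gpd T) \<beta> \<alpha> = Comp (gpd T) \<delta> \<gamma>}"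

text \<open>
  Meromorphic functions in the library are total, with unspecified values at poles, so an identity
  of meromorphic functions means, for each matrix coefficient, equality outside a sparse set
  (\<open>\<forall>\<^sub>\<approx>\<close>). Each coefficient of the identities below involves only finitely many coefficients of
  the operators, so this is the same as equality at every point where none of these has a pole,
  provided the functions take the right values off their poles. The Yang--Baxter equation is in
  two variables; holding for generic \<open>w\<close> and then generic \<open>z\<close>, it extends by continuity to all
  \<open>(z, w)\<close> such that none of the coefficients involved has a pole at \<open>z - w\<close>, \<open>z\<close> or \<open>w\<close>.
\<close>

lemma mero_identity_at_regular_point:
  fixes f g :: "complex \<Rightarrow> complex"
  assumes "\<forall>\<^sub>\<approx>z. f z = g z" "f analytic_on {z}" "g analytic_on {z}"
  shows "f z = g z"
proof -
  have "isCont f z" "isCont g z"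
    using assms(2,3) by (auto intro: analytic_at_imp_isCont)
  hence "f \<midarrow>z\<rightarrow> f z" "g \<midarrow>z\<rightarrow> g z"
    by (auto simp: isCont_def)
  moreover have "eventually (\<lambda>w. f w = g w) (at z)"
    using eventually_cosparse_imp_eventually_at[OF assms(1)] by auto
  ultimately have "f \<midarrow>z\<rightarrow> g z"
    using tendsto_cong by fastforce
  with \<open>f \<midarrow>z\<rightarrow> f z\<close> show ?thesis
    using LIM_unique by blast
qed

definition yang_baxter_operator :: "('o, 'a) triple \<Rightarrow> bool" where
  "yang_baxter_operator T \<longleftrightarrow>
     (\<forall>z. rmat T z \<in> graded_End T) \<and>
     (\<forall>p q. (\<lambda>z. rmat T z p q) meromorphic_on UNIV) \<and>
     (\<forall>p \<in> idx (space_of T \<otimes> space_of T \<otimes> space_of T). \<forall>q. \<forall>\<^sub>\<approx>w. \<forall>\<^sub>\<approx>z.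
        (on23 (rmat T (z - w)) \<odot> on12 (rmat T z) \<odot> on23 (rmat T w)) p q =
        (on12 (rmat T w) \<odot> on23 (rmat T z) \<odot> on12 (rmat T (z - w))) p q) \<and>
     (\<forall>p q. \<forall>\<^sub>\<approx>z. (rmat T z \<odot> rmat T (- z)) p q = mid (space_of T \<otimes> space_of T) p q)"

text \<open>
  The defining formula of the transpose, \<open>(R\<^sup>T) (\<delta>\<inverse>, \<gamma>\<inverse>) (\<beta>\<inverse>, \<alpha>\<inverse>) = R (\<alpha>, \<beta>) (\<gamma>, \<delta>)\<close>, solved for
  the entries of \<open>R\<^sup>T\<close>, using that inversion is an involution of the arrows.
\<close>

definition mtranspose :: "('o, 'a) triple \<Rightarrow> ('a \<times> 'a, 'a \<times> 'a) mat \<Rightarrow> ('a \<times> 'a, 'a \<times> 'a) mat" where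
  "mtranspose T M = (\<lambda>(\<alpha>, \<beta>) (\<gamma>, \<delta>).
     if (\<alpha>, \<beta>) \<in> idx (space_of T \<otimes> space_of T) \<and> (\<gamma>, \<delta>) \<in> idx (space_of T \<otimes> space_of T)
     then M (Inv (gpd T) \<delta>, Inv (gpd T) \<gamma>) (Inv (gpd T) \<beta>, Inv (gpd T) \<alpha>) else 0)"

definition symmetric_operator :: "('o, 'a) triple \<Rightarrow> bool" where
  "symmetric_operator T \<longleftrightarrow> (\<forall>p q. \<forall>\<^sub>\<approx>z. mtranspose T (rmat T z) p q = rmat T z p q)"

definition symmetric_yb_triples :: "('o, 'a) triple set" where
  "symmetric_yb_triples = {T. is_groupoid (gpd T) \<and> finite_type_space T \<and>
     yang_baxter_operator T \<and> symmetric_operator T}"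


section \<open>Intertwiners\<close>

text \<open>
  \<open>K\<close> stands for a connecting set \<open>\<pi>\<close> with its maps \<open>s\<^sub>\<pi>\<close>, \<open>t\<^sub>\<pi>\<close>, and also for the space
  \<open>V\<^sup>\<pi>\<close>, in which a basis vector of each line \<open>V\<^sup>\<pi>\<^sub>\<beta>\<close> has been chosen.
\<close>

definition connecting_set ::
    "('o1, 'a1) groupoid \<Rightarrow> ('o2, 'a2) groupoid \<Rightarrow> ('o1, 'o2, 'c) lines \<Rightarrow> bool" where
  "connecting_set G1 G2 K \<longleftrightarrow>
     src K ` idx K = Ob G1 \<and> tgt K ` idx K = Ob G2 \<and>
     (\<forall>a \<in> Ob G1. finite {\<beta> \<in> idx K. src K \<beta> = a}) \<and>
     (\<forall>b \<in> Ob G2. finite {\<beta> \<in> idx K. tgt K \<beta> = b})"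

definition intertwiner ::
    "('o1, 'a1) triple \<Rightarrow> ('o2, 'a2) triple \<Rightarrow> ('o1, 'o2, 'c) lines \<Rightarrow>
     ('a1 \<times> 'c, 'c \<times> 'a2) mat \<Rightarrow> bool" where
  "intertwiner T1 T2 K C \<longleftrightarrow>
     connecting_set (gpd T1) (gpd T2) K \<and>
     C \<in> Hom (space_of T1 \<otimes> K) (K \<otimes> space_of T2) \<and>
     (\<forall>p \<in> idx (space_of T1 \<otimes> space_of T1 \<otimes> K). \<forall>q. \<forall>\<^sub>\<approx>z.
        (on12 C \<odot> on23 C \<odot> on12 (rmat T1 z)) p q = (on23 (rmat T2 z) \<odot> on12 C \<odot> on23 C) p q)"

definition invertible_intertwiner ::
    "('o1, 'a1) triple \<Rightarrow> ('o2, 'a2) triple \<Rightarrow> ('o1, 'o2, 'c) lines \<Rightarrow>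
     ('a1 \<times> 'c, 'c \<times> 'a2) mat \<Rightarrow> bool" where
  "invertible_intertwiner T1 T2 K C \<longleftrightarrow>
     intertwiner T1 T2 K C \<and>
     (\<exists>D \<in> Hom (K \<otimes> space_of T2) (space_of T1 \<otimes> K).
        D \<odot> C = mid (space_of T1 \<otimes> K) \<and> C \<odot> D = mid (K \<otimes> space_of T2))"

text \<open>
  HOL cannot quantify existentially over the type of the elements of the connecting set. Every
  connecting set has finite fibres over \<open>Ob \<pi>\<^sub>1\<close>, so it is isomorphic to one with elements in
  \<open>Ob \<pi>\<^sub>1 \<times> Ob \<pi>\<^sub>2 \<times> \<nat>\<close>; \<open>yb_equivalentI\<close> below shows that this choice of type loses nothing.
\<close>

definition yb_equivalent :: "('o1, 'a1) triple \<Rightarrow> ('o2, 'a2) triple \<Rightarrow> bool" where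
  "yb_equivalent T1 T2 \<longleftrightarrow>
     (\<exists>(K :: ('o1, 'o2, 'o1 \<times> 'o2 \<times> nat) lines) C. invertible_intertwiner T1 T2 K C)"


text \<open>
  Proof of \<open>yb_equivalentI\<close>: relabelling the elements of the connecting set along an injection.
\<close>

definition relabelled ::
    "('p \<Rightarrow> 'p') \<Rightarrow> 'p set \<Rightarrow> ('q \<Rightarrow> 'q') \<Rightarrow> 'q set \<Rightarrow> ('p, 'q) mat \<Rightarrow> ('p', 'q') mat \<Rightarrow> bool" where
  "relabelled \<phi> A \<psi> B M M' \<longleftrightarrow>
     (\<forall>p \<in> A. \<forall>q \<in> B. M' (\<phi> p) (\<psi> q) = M p q) \<and>
     (\<forall>p \<in> A. \<forall>q. M p q \<noteq> 0 \<longrightarrow> q \<in> B) \<and>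
     (\<forall>p \<in> A. \<forall>q'. M' (\<phi> p) q' \<noteq> 0 \<longrightarrow> q' \<in> \<psi> ` B)"

lemma mcomp_nonzeroE:
  assumes "(N \<odot> M) p q \<noteq> 0"
  obtains j where "M p j \<noteq> 0" "N j q \<noteq> 0"
proof -
  have "\<exists>j. M p j * N j q \<noteq> 0"
  proof (rule ccontr)
    assume "\<nexists>j. M p j * N j q \<noteq> 0"
    hence none: "{j. M p j * N j q \<noteq> 0} = {}" by blast
    have "(N \<odot> M) p q = 0"
      unfolding mcomp_def Sum_any.expand_set none by (rule sum.empty)
    with assms show False by contradiction
  qed
  thus ?thesis using that by auto
qed

lemma relabelled_mcomp:
  assumes M: "relabelled \<phi> A \<psi> B M M'" and N: "relabelled \<psi> B \<theta> E N N'" and inj: "inj_on \<psi> B"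
  shows "relabelled \<phi> A \<theta> E (N \<odot> M) (N' \<odot> M')"
  unfolding relabelled_def
proof (intro conjI ballI allI impI)
  fix p q assume p: "p \<in> A" and q: "q \<in> E"
  let ?h = "\<lambda>j. M p j * N j q" and ?h' = "\<lambda>j. M' (\<phi> p) j * N' j (\<theta> q)"
  have h: "?h' (\<psi> j) = ?h j" if "j \<in> B" for j
    using M N p q that by (simp add: relabelled_def)
  have sub: "{j. ?h j \<noteq> 0} \<subseteq> B"
    using M p by (auto simp: relabelled_def)
  have "{j'. ?h' j' \<noteq> 0} = \<psi> ` {j. ?h j \<noteq> 0}"
  proof (intro equalityI subsetI)
    fix j' assume j': "j' \<in> {j'. ?h' j' \<noteq> 0}"
    hence "M' (\<phi> p) j' \<noteq> 0" by auto
    hence "j' \<in> \<psi> ` B"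
      using M p unfolding relabelled_def by blast
    then obtain j where "j \<in> B" "j' = \<psi> j" by auto
    moreover have "?h j \<noteq> 0"
    proof
      assume "?h j = 0"
      with h[of j] \<open>j \<in> B\<close> \<open>j' = \<psi> j\<close> have "?h' j' = 0" by simp
      with j' show False by blast
    qed
    ultimately show "j' \<in> \<psi> ` {j. ?h j \<noteq> 0}" by blast
  next
    fix j' assume "j' \<in> \<psi> ` {j. ?h j \<noteq> 0}"
    then obtain j where j: "j' = \<psi> j" "?h j \<noteq> 0" by auto
    with sub have "j \<in> B" by blast
    hence "?h' j' = ?h j" using h[of j] j(1) by simp
    hence "?h' j' \<noteq> 0" using j(2) by argo
    thus "j' \<in> {j'. ?h' j' \<noteq> 0}" by blast
  qed
  hence "sum ?h' {j'. ?h' j' \<noteq> 0} = sum ?h' (\<psi> ` {j. ?h j \<noteq> 0})"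
    by simp
  also have "\<dots> = sum (?h' \<circ> \<psi>) {j. ?h j \<noteq> 0}"
    by (rule sum.reindex) (use inj sub in \<open>blast intro: inj_on_subset\<close>)
  also have "\<dots> = sum ?h {j. ?h j \<noteq> 0}"
    by (rule sum.cong[OF refl]) (use h sub in \<open>unfold comp_def, blast\<close>)
  finally show "(N' \<odot> M') (\<phi> p) (\<theta> q) = (N \<odot> M) p q"
    by (simp only: mcomp_def Sum_any.expand_set)
next
  fix p q assume p: "p \<in> A" and "(N \<odot> M) p q \<noteq> 0"
  then obtain j where j: "M p j \<noteq> 0" "N j q \<noteq> 0"
    by (rule_tac mcomp_nonzeroE) auto
  hence "j \<in> B"
    using M p unfolding relabelled_def by blast
  thus "q \<in> E"
    using N j unfolding relabelled_def by blast
next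
  fix p q' assume p: "p \<in> A" and "(N' \<odot> M') (\<phi> p) q' \<noteq> 0"
  then obtain j' where j': "M' (\<phi> p) j' \<noteq> 0" "N' j' q' \<noteq> 0"
    by (rule_tac mcomp_nonzeroE) auto
  then obtain j where "j \<in> B" "j' = \<psi> j"
    using M p unfolding relabelled_def by blast
  thus "q' \<in> \<theta> ` E"
    using N j' unfolding relabelled_def by blast
qed

lemma relabelled_mid:
  assumes P: "relabelled \<phi> A \<phi> A P P'" and inj: "inj_on \<phi> A"
    and P0: "\<And>p' q'. p' \<notin> \<phi> ` A \<Longrightarrow> P' p' q' = 0"
    and sub: "idx V \<subseteq> A" and V': "idx V' = \<phi> ` idx V" and eq: "P = mid V"
  shows "P' = mid V'"
proof (intro ext)
  fix p' q'
  show "P' p' q' = mid V' p' q'"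
  proof (cases "p' \<in> \<phi> ` A \<and> q' \<in> \<phi> ` A")
    case True
    then obtain p q where pq: "p \<in> A" "q \<in> A" "p' = \<phi> p" "q' = \<phi> q" by auto
    hence "P' p' q' = mid V p q"
      using P eq by (auto simp: relabelled_def)
    moreover have "\<phi> p = \<phi> q \<longleftrightarrow> p = q" "\<phi> p \<in> \<phi> ` idx V \<longleftrightarrow> p \<in> idx V"
      using inj sub pq by (auto dest: inj_onD)
    ultimately show ?thesis
      using pq by (simp add: mid_def V')
  next
    case False
    hence "P' p' q' = 0"
      using P P0[of p' q'] unfolding relabelled_def by blast
    moreover have "mid V' p' q' = 0"
      using False sub by (auto simp: mid_def V')
    ultimately show ?thesis by simp
  qed
qed

lemma invertible_intertwiner_relabel:
  fixes T1 :: "('o1, 'b) triple" and T2 :: "('o2, 'e) triple"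
    and K :: "('o1, 'o2, 'c) lines" and f :: "'c \<Rightarrow> 'd"
  assumes C: "invertible_intertwiner T1 T2 K C" and f: "inj_on f (idx K)"
  shows "\<exists>(K' :: ('o1, 'o2, 'd) lines) C'. invertible_intertwiner T1 T2 K' C'"
proof -
  let ?I = "idx K"
  define g where "g = inv_into ?I f"
  have g [simp]: "g (f \<beta>) = \<beta>" if "\<beta> \<in> ?I" for \<beta>
    using f that by (simp add: g_def)
  have f_eq [simp]: "f \<beta> = f \<beta>' \<longleftrightarrow> \<beta> = \<beta>'" if "\<beta> \<in> ?I" "\<beta>' \<in> ?I" for \<beta> \<beta>'
    using f that by (auto dest: inj_onD)
  define K' :: "('o1, 'o2, 'd) lines" where "K' = \<lparr> idx = f ` ?I, src = src K \<circ> g, tgt = tgt K \<circ> g \<rparr>"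
  define C' where "C' = (\<lambda>(\<alpha>, b) (b', \<gamma>).
    if b \<in> f ` ?I \<and> b' \<in> f ` ?I then C (\<alpha>, g b) (g b', \<gamma>) else 0)"
  obtain D where D: "D \<in> Hom (K \<otimes> space_of T2) (space_of T1 \<otimes> K)"
    and DC: "D \<odot> C = mid (space_of T1 \<otimes> K)" and CD: "C \<odot> D = mid (K \<otimes> space_of T2)"
    using C by (auto simp: invertible_intertwiner_def)
  define D' where "D' = (\<lambda>(b', \<gamma>) (\<alpha>, b).
    if b \<in> f ` ?I \<and> b' \<in> f ` ?I then D (g b', \<gamma>) (\<alpha>, g b) else 0)"
  have CH: "C \<in> Hom (space_of T1 \<otimes> K) (K \<otimes> space_of T2)"
    and conn: "connecting_set (gpd T1) (gpd T2) K"
    using C by (auto simp: invertible_intertwiner_def intertwiner_def)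
  have Ci: "\<beta> \<in> ?I \<and> \<beta>' \<in> ?I" if "C (\<alpha>, \<beta>) (\<beta>', \<gamma>) \<noteq> 0" for \<alpha> \<beta> \<beta>' \<gamma>
    using CH that unfolding Hom_def tensor_def by fastforce
  have Di: "\<beta> \<in> ?I \<and> \<beta>' \<in> ?I" if "D (\<beta>', \<gamma>) (\<alpha>, \<beta>) \<noteq> 0" for \<alpha> \<beta> \<beta>' \<gamma>
    using D that unfolding Hom_def tensor_def by fastforce
  define A where "A = (UNIV :: 'b set) \<times> ?I"
  define B where "B = ?I \<times> (UNIV :: 'e set)"
  define a :: "'b \<times> 'c \<Rightarrow> 'b \<times> 'd" where "a = (\<lambda>(\<alpha>, \<beta>). (\<alpha>, f \<beta>))"
  define b :: "'c \<times> 'e \<Rightarrow> 'd \<times> 'e" where "b = (\<lambda>(\<beta>, \<gamma>). (f \<beta>, \<gamma>))"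
  define A1 where "A1 = (UNIV :: 'b set) \<times> (UNIV :: 'b set) \<times> ?I"
  define A2 where "A2 = (UNIV :: 'b set) \<times> ?I \<times> (UNIV :: 'e set)"
  define A3 where "A3 = ?I \<times> (UNIV :: 'e set) \<times> (UNIV :: 'e set)"
  define a1 :: "'b \<times> 'b \<times> 'c \<Rightarrow> 'b \<times> 'b \<times> 'd" where "a1 = (\<lambda>(x, y, z). (x, y, f z))"
  define a2 :: "'b \<times> 'c \<times> 'e \<Rightarrow> 'b \<times> 'd \<times> 'e" where "a2 = (\<lambda>(x, y, z). (x, f y, z))"
  define a3 :: "'c \<times> 'e \<times> 'e \<Rightarrow> 'd \<times> 'e \<times> 'e" where "a3 = (\<lambda>(x, y, z). (f x, y, z))"
  have inj: "inj_on a A" "inj_on b B" "inj_on a1 A1" "inj_on a2 A2" "inj_on a3 A3"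
    by (auto simp: inj_on_def a_def A_def b_def B_def a1_def A1_def a2_def A2_def a3_def A3_def)
  have img: "(x, z') \<in> a ` A \<longleftrightarrow> z' \<in> f ` ?I" "(z', y) \<in> b ` B \<longleftrightarrow> z' \<in> f ` ?I"
    "(x, x', z') \<in> a1 ` A1 \<longleftrightarrow> z' \<in> f ` ?I" "(x, z', y) \<in> a2 ` A2 \<longleftrightarrow> z' \<in> f ` ?I"
    "(z', y, y') \<in> a3 ` A3 \<longleftrightarrow> z' \<in> f ` ?I" for x x' y y' z'
    by (auto simp: a_def A_def b_def B_def a1_def A1_def a2_def A2_def a3_def A3_def image_iff)
  have C'f: "C' (\<alpha>, f \<beta>) (f \<beta>', \<gamma>) = C (\<alpha>, \<beta>) (\<beta>', \<gamma>)" if "\<beta> \<in> ?I" "\<beta>' \<in> ?I" for \<alpha> \<beta> \<beta>' \<gamma>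
    using that by (simp add: C'_def)
  have D'f: "D' (f \<beta>', \<gamma>) (\<alpha>, f \<beta>) = D (\<beta>', \<gamma>) (\<alpha>, \<beta>)" if "\<beta> \<in> ?I" "\<beta>' \<in> ?I" for \<alpha> \<beta> \<beta>' \<gamma>
    using that by (simp add: D'_def)
  have C'i: "z \<in> f ` ?I \<and> z' \<in> f ` ?I" if "C' (\<alpha>, z) (z', \<gamma>) \<noteq> 0" for \<alpha> z z' \<gamma>
    using that by (simp add: C'_def split: if_splits)
  have D'i: "z \<in> f ` ?I \<and> z' \<in> f ` ?I" if "D' (z', \<gamma>) (\<alpha>, z) \<noteq> 0" for \<alpha> z z' \<gamma>
    using that by (simp add: D'_def split: if_splits)
  have relC: "relabelled a A b B C C'"
    unfolding relabelled_def
  proof (intro conjI ballI allI impI)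
    show "C' (a p) (b q) = C p q" if "p \<in> A" "q \<in> B" for p q
      using that by (cases p; cases q) (simp add: a_def b_def A_def B_def C'f)
    show "q \<in> B" if "p \<in> A" "C p q \<noteq> 0" for p q
      using that Ci by (cases p; cases q) (simp add: B_def)
    show "q' \<in> b ` B" if "p \<in> A" "C' (a p) q' \<noteq> 0" for p q'
      using that C'i by (cases p; cases q') (simp add: img a_def)
  qed
  have relD: "relabelled b B a A D D'"
    unfolding relabelled_def
  proof (intro conjI ballI allI impI)
    show "D' (b p) (a q) = D p q" if "p \<in> B" "q \<in> A" for p q
      using that by (cases p; cases q) (simp add: a_def b_def A_def B_def D'f)
    show "q \<in> A" if "p \<in> B" "D p q \<noteq> 0" for p q
      using that Di by (cases p; cases q) (simp add: A_def)
    show "q' \<in> a ` A" if "p \<in> B" "D' (b p) q' \<noteq> 0" for p q'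
      using that D'i by (cases p; cases q') (simp add: img b_def)
  qed
  have rel23: "relabelled a1 A1 a2 A2 (on23 C) (on23 C')"
    unfolding relabelled_def
  proof (intro conjI ballI allI impI)
    show "on23 C' (a1 p) (a2 q) = on23 C p q" if "p \<in> A1" "q \<in> A2" for p q
      using that by (cases p; cases q) (simp add: a1_def a2_def A1_def A2_def on23_def C'f split: prod.splits)
    show "q \<in> A2" if "p \<in> A1" "on23 C p q \<noteq> 0" for p q
      using that Ci by (cases p; cases q) (auto simp: A2_def on23_def split: if_splits)
    show "q' \<in> a2 ` A2" if "p \<in> A1" "on23 C' (a1 p) q' \<noteq> 0" for p q'
      using that C'i by (cases p; cases q') (auto simp: img a1_def on23_def split: if_splits)
  qed
  have rel12: "relabelled a2 A2 a3 A3 (on12 C) (on12 C')"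
    unfolding relabelled_def
  proof (intro conjI ballI allI impI)
    show "on12 C' (a2 p) (a3 q) = on12 C p q" if "p \<in> A2" "q \<in> A3" for p q
      using that by (cases p; cases q) (simp add: a2_def a3_def A2_def A3_def on12_def C'f split: prod.splits)
    show "q \<in> A3" if "p \<in> A2" "on12 C p q \<noteq> 0" for p q
      using that Ci by (cases p; cases q) (auto simp: A3_def on12_def split: if_splits)
    show "q' \<in> a3 ` A3" if "p \<in> A2" "on12 C' (a2 p) q' \<noteq> 0" for p q'
      using that C'i by (cases p; cases q') (auto simp: img a2_def on12_def split: if_splits)
  qed
  have relR1: "relabelled a1 A1 a1 A1 (on12 R) (on12 R)" for R
    unfolding relabelled_def
  proof (intro conjI ballI allI impI)
    show "on12 R (a1 p) (a1 q) = on12 R p q" if "p \<in> A1" "q \<in> A1" for p q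
      using that by (cases p; cases q) (auto simp: a1_def A1_def on12_def)
    show "q \<in> A1" if "p \<in> A1" "on12 R p q \<noteq> 0" for p q
      using that by (cases p; cases q) (auto simp: A1_def on12_def split: if_splits)
    show "q' \<in> a1 ` A1" if "p \<in> A1" "on12 R (a1 p) q' \<noteq> 0" for p q'
      proof -
      obtain x y z x' y' z' where pq: "p = (x, y, z)" "q' = (x', y', z')"
        by (cases p; cases q') auto
      have "z \<in> ?I" "z' = f z"
        using that by (auto simp: pq A1_def a1_def on12_def split: if_splits)
      thus ?thesis by (simp add: pq img)
    qed
  qed
  have relR2: "relabelled a3 A3 a3 A3 (on23 R) (on23 R)" for R
    unfolding relabelled_def
  proof (intro conjI ballI allI impI)
    show "on23 R (a3 p) (a3 q) = on23 R p q" if "p \<in> A3" "q \<in> A3" for p q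
      using that by (cases p; cases q) (auto simp: a3_def A3_def on23_def)
    show "q \<in> A3" if "p \<in> A3" "on23 R p q \<noteq> 0" for p q
      using that by (cases p; cases q) (auto simp: A3_def on23_def split: if_splits)
    show "q' \<in> a3 ` A3" if "p \<in> A3" "on23 R (a3 p) q' \<noteq> 0" for p q'
      proof -
      obtain x y z x' y' z' where pq: "p = (x, y, z)" "q' = (x', y', z')"
        by (cases p; cases q') auto
      have "x \<in> ?I" "x' = f x"
        using that by (auto simp: pq A3_def a3_def on23_def split: if_splits)
      thus ?thesis by (simp add: pq img)
    qed
  qed
  have CH': "p \<in> idx (space_of T1 \<otimes> K) \<and> q \<in> idx (K \<otimes> space_of T2) \<and>
      src (space_of T1 \<otimes> K) p = src (K \<otimes> space_of T2) q \<and>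
      tgt (space_of T1 \<otimes> K) p = tgt (K \<otimes> space_of T2) q" if "C p q \<noteq> 0" for p q
    using CH[unfolded Hom_def, THEN CollectD, rule_format, OF that] by blast
  have DH': "q \<in> idx (space_of T1 \<otimes> K) \<and> p \<in> idx (K \<otimes> space_of T2) \<and>
      src (space_of T1 \<otimes> K) q = src (K \<otimes> space_of T2) p \<and>
      tgt (space_of T1 \<otimes> K) q = tgt (K \<otimes> space_of T2) p" if "D p q \<noteq> 0" for p q
    using D[unfolded Hom_def, THEN CollectD, rule_format, OF that] by (intro conjI) simp_all
  have C'H: "C' \<in> Hom (space_of T1 \<otimes> K') (K' \<otimes> space_of T2)"
    unfolding Hom_def
  proof (intro CollectI allI impI)
    fix p q assume nz: "C' p q \<noteq> 0"
    obtain \<alpha> z z' \<gamma> where pq: "p = (\<alpha>, z)" "q = (z', \<gamma>)" by (cases p; cases q) auto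
    then obtain \<beta> \<beta>' where \<beta>: "\<beta> \<in> ?I" "\<beta>' \<in> ?I" "z = f \<beta>" "z' = f \<beta>'"
      using C'i nz by blast
    hence "C (\<alpha>, \<beta>) (\<beta>', \<gamma>) \<noteq> 0"
      using nz pq C'f by auto
    from CH'[OF this] \<beta> pq show "p \<in> idx (space_of T1 \<otimes> K') \<and> q \<in> idx (K' \<otimes> space_of T2) \<and>
        src (space_of T1 \<otimes> K') p = src (K' \<otimes> space_of T2) q \<and>
        tgt (space_of T1 \<otimes> K') p = tgt (K' \<otimes> space_of T2) q"
      by (simp add: tensor_def K'_def)
  qed
  have D'H: "D' \<in> Hom (K' \<otimes> space_of T2) (space_of T1 \<otimes> K')"
    unfolding Hom_def
  proof (intro CollectI allI impI)
    fix p q assume nz: "D' p q \<noteq> 0"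
    obtain \<alpha> z z' \<gamma> where pq: "q = (\<alpha>, z)" "p = (z', \<gamma>)" by (cases p; cases q) auto
    then obtain \<beta> \<beta>' where \<beta>: "\<beta> \<in> ?I" "\<beta>' \<in> ?I" "z = f \<beta>" "z' = f \<beta>'"
      using D'i nz by blast
    hence "D (\<beta>', \<gamma>) (\<alpha>, \<beta>) \<noteq> 0"
      using nz pq D'f by auto
    from DH'[OF this] \<beta> pq show "p \<in> idx (K' \<otimes> space_of T2) \<and> q \<in> idx (space_of T1 \<otimes> K') \<and>
        src (K' \<otimes> space_of T2) p = src (space_of T1 \<otimes> K') q \<and>
        tgt (K' \<otimes> space_of T2) p = tgt (space_of T1 \<otimes> K') q"
      by (simp add: tensor_def K'_def)
  qed
  have "D' \<odot> C' = mid (space_of T1 \<otimes> K')"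
  proof (rule relabelled_mid[OF _ inj(1) _ _ _ DC])
    show "relabelled a A a A (D \<odot> C) (D' \<odot> C')"
      by (rule relabelled_mcomp[OF relC relD inj(2)])
    show "(D' \<odot> C') p' q' = 0" if "p' \<notin> a ` A" for p' q'
    proof (rule ccontr)
      assume "(D' \<odot> C') p' q' \<noteq> 0"
      then obtain j where "C' p' j \<noteq> 0" by (rule mcomp_nonzeroE)
      thus False using that by (cases p'; cases j) (auto simp: C'_def a_def A_def image_iff split: if_splits)
    qed
    show "idx (space_of T1 \<otimes> K) \<subseteq> A"
      by (auto simp: tensor_def A_def)
    show "idx (space_of T1 \<otimes> K') = a ` idx (space_of T1 \<otimes> K)"
      by (auto simp: tensor_def a_def K'_def image_iff)
  qed
  moreover have "C' \<odot> D' = mid (K' \<otimes> space_of T2)"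
  proof (rule relabelled_mid[OF _ inj(2) _ _ _ CD])
    show "relabelled b B b B (C \<odot> D) (C' \<odot> D')"
      by (rule relabelled_mcomp[OF relD relC inj(1)])
    show "(C' \<odot> D') p' q' = 0" if "p' \<notin> b ` B" for p' q'
    proof (rule ccontr)
      assume "(C' \<odot> D') p' q' \<noteq> 0"
      then obtain j where "D' p' j \<noteq> 0" by (rule mcomp_nonzeroE)
      thus False using that by (cases p'; cases j) (auto simp: D'_def b_def B_def image_iff split: if_splits)
    qed
    show "idx (K \<otimes> space_of T2) \<subseteq> B"
      by (auto simp: tensor_def B_def)
    show "idx (K' \<otimes> space_of T2) = b ` idx (K \<otimes> space_of T2)"
      by (auto simp: tensor_def b_def K'_def image_iff)
  qed
  moreover have "connecting_set (gpd T1) (gpd T2) K'"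
  proof -
    have fib: "{\<beta> \<in> idx K'. src K' \<beta> = x} = f ` {\<beta> \<in> ?I. src K \<beta> = x}"
      "{\<beta> \<in> idx K'. tgt K' \<beta> = y} = f ` {\<beta> \<in> ?I. tgt K \<beta> = y}" for x y
      by (auto simp: K'_def)
    have "src K' ` idx K' = src K ` ?I" "tgt K' ` idx K' = tgt K ` ?I"
      by (auto simp: K'_def image_image)
    thus ?thesis
      using conn unfolding connecting_set_def fib by auto
  qed
  moreover have "\<forall>\<^sub>\<approx>z. (on12 C' \<odot> on23 C' \<odot> on12 (rmat T1 z)) p' q' =
      (on23 (rmat T2 z) \<odot> on12 C' \<odot> on23 C') p' q'"
    if p': "p' \<in> idx (space_of T1 \<otimes> space_of T1 \<otimes> K')" for p' q'
  proof -
    have L: "relabelled a1 A1 a3 A3 (on12 C \<odot> on23 C \<odot> on12 (rmat T1 z))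
        (on12 C' \<odot> on23 C' \<odot> on12 (rmat T1 z))" for z
      by (intro relabelled_mcomp[OF _ rel12 inj(4)] relabelled_mcomp[OF relR1 rel23 inj(3)])
    have R: "relabelled a1 A1 a3 A3 (on23 (rmat T2 z) \<odot> on12 C \<odot> on23 C)
        (on23 (rmat T2 z) \<odot> on12 C' \<odot> on23 C')" for z
      by (intro relabelled_mcomp[OF _ relR2 inj(5)] relabelled_mcomp[OF rel23 rel12 inj(4)])
    have "idx (space_of T1 \<otimes> space_of T1 \<otimes> K') = a1 ` idx (space_of T1 \<otimes> space_of T1 \<otimes> K)"
      by (force simp: tensor_def a1_def K'_def image_iff)
    then obtain p where p: "p \<in> idx (space_of T1 \<otimes> space_of T1 \<otimes> K)" "p' = a1 p"
      using p' by auto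
    have pA: "p \<in> A1"
      using p by (auto simp: tensor_def A1_def)
    show ?thesis
    proof (cases "q' \<in> a3 ` A3")
      case True
      then obtain q where q: "q \<in> A3" "q' = a3 q" by auto
      have "(on12 C' \<odot> on23 C' \<odot> on12 (rmat T1 z)) p' q' =
          (on12 C \<odot> on23 C \<odot> on12 (rmat T1 z)) p q" for z
        using L[of z] pA q p by (simp add: relabelled_def)
      moreover have "(on23 (rmat T2 z) \<odot> on12 C' \<odot> on23 C') p' q' =
          (on23 (rmat T2 z) \<odot> on12 C \<odot> on23 C) p q" for z
        using R[of z] pA q p by (simp add: relabelled_def)
      moreover have "\<forall>\<^sub>\<approx>z. (on12 C \<odot> on23 C \<odot> on12 (rmat T1 z)) p q =
          (on23 (rmat T2 z) \<odot> on12 C \<odot> on23 C) p q"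
        using C p unfolding invertible_intertwiner_def intertwiner_def by blast
      ultimately show ?thesis by simp
    next
      case False
      have "(on12 C' \<odot> on23 C' \<odot> on12 (rmat T1 z)) p' q' = 0" for z
        using L[of z] pA p False unfolding relabelled_def by blast
      moreover have "(on23 (rmat T2 z) \<odot> on12 C' \<odot> on23 C') p' q' = 0" for z
        using R[of z] pA p False unfolding relabelled_def by blast
      ultimately show ?thesis by simp
    qed
  qed
  ultimately have "invertible_intertwiner T1 T2 K' C'"
    using C'H D'H unfolding invertible_intertwiner_def intertwiner_def by blast
  thus ?thesis by blast
qed

lemma yb_equivalentI:
  fixes T1 :: "('o1, 'a1) triple" and T2 :: "('o2, 'a2) triple"
    and K :: "('o1, 'o2, 'c) lines"
  assumes C: "invertible_intertwiner T1 T2 K C"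
  shows "yb_equivalent T1 T2"
proof -
  have conn: "connecting_set (gpd T1) (gpd T2) K"
    using C by (auto simp: invertible_intertwiner_def intertwiner_def)
  let ?F = "\<lambda>x. {\<beta> \<in> idx K. src K \<beta> = x}"
  define n :: "'o1 \<Rightarrow> 'c \<Rightarrow> nat" where "n x = (SOME h. inj_on h (?F x))" for x
  have n: "inj_on (n x) (?F x)" if "x \<in> src K ` idx K" for x
  proof -
    have "finite (?F x)"
      using conn that unfolding connecting_set_def by auto
    hence "\<exists>h :: 'c \<Rightarrow> nat. inj_on h (?F x)"
      using finite_imp_inj_to_nat_seg by blast
    thus ?thesis unfolding n_def by (rule someI_ex)
  qed
  define f where "f \<beta> = (src K \<beta>, tgt K \<beta>, n (src K \<beta>) \<beta>)" for \<beta>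
  have "inj_on f (idx K)"
  proof (rule inj_onI)
    fix \<beta> \<beta>' assume I: "\<beta> \<in> idx K" "\<beta>' \<in> idx K" and eq: "f \<beta> = f \<beta>'"
    hence s: "src K \<beta>' = src K \<beta>" and "n (src K \<beta>) \<beta> = n (src K \<beta>) \<beta>'"
      by (auto simp: f_def)
    with n[of "src K \<beta>"] I show "\<beta> = \<beta>'"
      by (auto dest: inj_onD)
  qed
  from invertible_intertwiner_relabel[OF C this] show ?thesis
    unfolding yb_equivalent_def .
qed


section \<open>Partial traces\<close>

text \<open>
  The partial trace over the middle line \<open>U\<^sub>\<beta>\<close> of \<open>M : V \<otimes> U \<rightarrow> U \<otimes> W\<close>. The line \<open>U\<^sub>\<beta>\<close> has a single
  basis vector, so the sum over its basis has a single term.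
\<close>

definition partial_trace ::
    "('s, 's, 'x) lines \<Rightarrow> ('s, 't, 'u) lines \<Rightarrow> ('t, 't, 'y) lines \<Rightarrow>
     ('x \<times> 'u, 'u \<times> 'y) mat \<Rightarrow> 'u \<Rightarrow> ('x, 'y) mat" where
  "partial_trace V U W M \<beta> = (\<lambda>\<alpha> \<gamma>.
     if \<alpha> \<in> paths V (src U \<beta>) (src U \<beta>) \<and> \<gamma> \<in> paths W (tgt U \<beta>) (tgt U \<beta>)
     then M (\<alpha>, \<beta>) (\<beta>, \<gamma>) else 0)"

text \<open>
  The \<open>(a, b)\<close> component of \<open>F * G\<close>. The sum runs over the pairs of indices in the supports of \<open>V\<close>
  and \<open>W\<close>; the remaining pairs of arrows have zero component.
\<close>

definition convolution ::
    "('s, 't, 'u) lines \<Rightarrow> ('t, 'r, 'v) lines \<Rightarrow> ('u \<Rightarrow> ('x, 'y) mat) \<Rightarrow> ('v \<Rightarrow> ('y, 'z) mat) \<Rightarrow>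
     's \<Rightarrow> 'r \<Rightarrow> ('x, 'z) mat" where
  "convolution V W F G a b = (\<lambda>\<alpha> \<gamma>. \<Sum>(\<xi>, \<eta>) \<in> paths (V \<otimes> W) a b. (G \<eta> \<odot> F \<xi>) \<alpha> \<gamma>)"

end

theory Submission
  imports Defs
begin

text \<open>
  An intertwiner moves the space \<open>V\<^sup>\<pi>\<close> from the right of \<open>V\<^sup>\<pi>\<^sup>1\<close> to the left of \<open>V\<^sup>\<pi>\<^sup>2\<close>, and everything
  follows by moving and reflecting such crossings.

  \<^item> Reflexivity (\<open>yb_equivalent_refl\<close>): the objects of the groupoid form a connecting set whose
    space is the unit of the tensor product, and moving the unit across a factor intertwines
    any operator that preserves endpoints.
  \<^item> Transitivity (\<open>yb_equivalent_compose\<close>): moving two connecting spaces one after the other,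
    \<open>C'\<^sup>(\<^sup>2\<^sup>3\<^sup>) C\<^sup>(\<^sup>1\<^sup>2\<^sup>)\<close>, is an intertwiner, because crossings that act on disjoint factors commute.
  \<^item> Symmetry (\<open>yb_equivalent_dual\<close>): reading strings backwards, with inverted arrows and
    transposed matrices, turns \<open>C\<close> into a crossing from \<open>\<pi>\<^sub>2\<close> to \<open>\<pi>\<^sub>1\<close>, and turns each \<open>R\<^sub>i\<close> into its
    transpose, which is \<open>R\<^sub>i\<close> because the operators are symmetric.
  \<^item> Trace identity (\<open>convolution_partial_traces_eq\<close>): the two convolutions are traces of
    \<open>C\<^sup>(\<^sup>2\<^sup>3\<^sup>) R\<^sub>1\<^sup>(\<^sup>1\<^sup>2\<^sup>)\<close> and \<open>R\<^sub>2\<^sup>(\<^sup>2\<^sup>3\<^sup>) C\<^sup>(\<^sup>1\<^sup>2\<^sup>)\<close>, which are conjugate by \<open>C\<close>, and the trace is cyclic.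

  Two points need care with matrices. The relations hold for generic \<open>z\<close>, with an exceptional set
  that depends on the coefficient; but there are only finitely many strings between two given
  endpoints, and all maps preserve endpoints, so for generic \<open>z\<close> all coefficients that enter a
  calculation satisfy them simultaneously (\<open>eventually_rows_on_paths\<close>). And maps acting on some of
  the factors do not vanish on strings that are not composable, so inverses and relations are
  available only row by row, on composable strings.
\<close>


section \<open>Composition of matrices with finite rows\<close>

text \<open>
  \<open>Sum_any\<close> returns 0 on an infinite support, so composition of arbitrary matrices is not
  associative. Finite rows are what makes it the composition of linear maps.
\<close>
definition row_finite :: "('x, 'y) mat \<Rightarrow> bool" where
  "row_finite M \<longleftrightarrow> (\<forall>p. finite {q. M p q \<noteq> 0})"

lemma mcomp_eq_sum:
  assumes "finite J" "\<And>j. M p j \<noteq> 0 \<Longrightarrow> N j q \<noteq> 0 \<Longrightarrow> j \<in> J"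
  shows "(N \<odot> M) p q = (\<Sum>j\<in>J. M p j * N j q)"
  unfolding mcomp_def using assms by (intro Sum_any.expand_superset) auto

lemma mcomp_single:
  assumes "\<And>j. M p j \<noteq> 0 \<Longrightarrow> N j q \<noteq> 0 \<Longrightarrow> j = j0"
  shows "(N \<odot> M) p q = M p j0 * N j0 q"
  using mcomp_eq_sum[of "{j0}" M p N q] assms by auto

lemma mcomp_cong_row: "M p = M' p \<Longrightarrow> (N \<odot> M) p = (N \<odot> M') p"
  by (simp add: mcomp_def fun_eq_iff)

text \<open>
  Only the rows of \<open>N\<close> that \<open>M\<close> reaches from \<open>p\<close> matter. The intertwining relations hold only on
  composable strings and only for generic \<open>z\<close>, so all later calculations compare single rows.
\<close>
lemma mcomp_cong_rows:
  assumes "\<And>j. M p j \<noteq> 0 \<Longrightarrow> N j = N' j"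
  shows "(N \<odot> M) p = (N' \<odot> M) p"
proof
  fix q
  have "M p j * N j q = M p j * N' j q" for j
    using assms[of j] by (cases "M p j = 0") auto
  thus "(N \<odot> M) p q = (N' \<odot> M) p q"
    unfolding mcomp_def by (rule Sum_any.cong)
qed

lemma row_finite_mcomp:
  assumes "row_finite M" "row_finite N"
  shows "row_finite (N \<odot> M)"
  unfolding row_finite_def
proof
  fix p
  have "{q. (N \<odot> M) p q \<noteq> 0} \<subseteq> (\<Union>j\<in>{j. M p j \<noteq> 0}. {q. N j q \<noteq> 0})"
    by (auto elim!: mcomp_nonzeroE)
  thus "finite {q. (N \<odot> M) p q \<noteq> 0}"
    by (rule finite_subset) (use assms in \<open>auto simp: row_finite_def\<close>)
qed

lemma mcomp_assoc:
  assumes "row_finite M" "row_finite N"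
  shows "(P \<odot> N) \<odot> M = P \<odot> N \<odot> M"
proof (intro ext)
  fix p q
  define J where "J = {j. M p j \<noteq> 0}"
  define L where "L = (\<Union>j\<in>J. {l. N j l \<noteq> 0})"
  have fin: "finite J" "finite L"
    using assms by (auto simp: J_def L_def row_finite_def)
  have "((P \<odot> N) \<odot> M) p q = (\<Sum>j\<in>J. M p j * (P \<odot> N) j q)"
    by (rule mcomp_eq_sum) (use fin in \<open>auto simp: J_def\<close>)
  also have "\<dots> = (\<Sum>j\<in>J. M p j * (\<Sum>l\<in>L. N j l * P l q))"
    by (intro sum.cong arg_cong2[of _ _ _ _ "(*)"] refl mcomp_eq_sum) (use fin in \<open>auto simp: L_def\<close>)
  also have "\<dots> = (\<Sum>l\<in>L. (\<Sum>j\<in>J. M p j * N j l) * P l q)"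
    unfolding sum_distrib_left sum_distrib_right mult.assoc by (rule sum.swap)
  also have "\<dots> = (\<Sum>l\<in>L. (N \<odot> M) p l * P l q)"
    by (intro sum.cong arg_cong2[of _ _ _ _ "(*)"] refl mcomp_eq_sum[symmetric]) (use fin in \<open>auto simp: J_def\<close>)
  also have "\<dots> = (P \<odot> N \<odot> M) p q"
    by (rule mcomp_eq_sum[symmetric]) (use fin in \<open>auto simp: L_def J_def elim!: mcomp_nonzeroE\<close>)
  finally show "((P \<odot> N) \<odot> M) p q = (P \<odot> N \<odot> M) p q" .
qed

text \<open>
  The common step behind the functoriality of \<^term>\<open>on12\<close>, \<^term>\<open>on23\<close> and partial traces: the
  intermediate strings that contribute are those with prescribed spectators.
\<close>
lemma mcomp_reindex:
  assumes inj: "inj f" and M: "\<And>j. M' p' j \<noteq> 0 \<Longrightarrow> N' j q' \<noteq> 0 \<Longrightarrow> j \<in> range f"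
    and eq: "\<And>i. M' p' (f i) * N' (f i) q' = M p i * N i q"
  shows "(N' \<odot> M') p' q' = (N \<odot> M) p q"
proof -
  have "{j. M' p' j * N' j q' \<noteq> 0} = f ` {i. M p i * N i q \<noteq> 0}"
  proof (intro equalityI subsetI)
    fix j assume j: "j \<in> {j. M' p' j * N' j q' \<noteq> 0}"
    hence "j \<in> range f" by (intro M) auto
    then obtain i where "j = f i" by blast
    with j eq[of i] show "j \<in> f ` {i. M p i * N i q \<noteq> 0}"
      by (metis (mono_tags, lifting) image_eqI mem_Collect_eq)
  next
    fix j assume "j \<in> f ` {i. M p i * N i q \<noteq> 0}"
    thus "j \<in> {j. M' p' j * N' j q' \<noteq> 0}"
      using eq by (metis (mono_tags, lifting) imageE mem_Collect_eq)
  qed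
  moreover have "inj_on f {i. M p i * N i q \<noteq> 0}"
    using inj by (rule inj_on_subset) simp
  ultimately show ?thesis
    unfolding mcomp_def Sum_any.expand_set by (simp add: sum.reindex eq)
qed


section \<open>Maps acting on some factors of a tensor product\<close>

text \<open>
  On strings of length four, \<^term>\<open>on12 M\<close>, \<^term>\<open>on23 (on12 M)\<close> and \<^term>\<open>on23 (on23 M)\<close> are
  \<open>M\<^sup>(\<^sup>1\<^sup>2\<^sup>)\<close>, \<open>M\<^sup>(\<^sup>2\<^sup>3\<^sup>)\<close> and \<open>M\<^sup>(\<^sup>3\<^sup>4\<^sup>)\<close>, since the last factor of a string may itself be a string. What is
  missing is a spectator on the right of a map on three factors.
\<close>
definition on123 ::
    "('x \<times> 'y \<times> 'z, 'x' \<times> 'y' \<times> 'z') mat \<Rightarrow> ('x \<times> 'y \<times> 'z \<times> 'w, 'x' \<times> 'y' \<times> 'z' \<times> 'w) mat" where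
  "on123 M = (\<lambda>(x, y, z, w) (x', y', z', w'). if w = w' then M (x, y, z) (x', y', z') else 0)"

lemma on12_apply [simp]: "on12 M (x, y, z) (x', y', z') = (if z = z' then M (x, y) (x', y') else 0)"
  by (simp add: on12_def)

lemma on23_apply [simp]: "on23 M (x, p) (x', q) = (if x = x' then M p q else 0)"
  by (cases p; cases q) (simp add: on23_def)

lemma on123_apply [simp]:
  "on123 M (x, y, z, w) (x', y', z', w') = (if w = w' then M (x, y, z) (x', y', z') else 0)"
  by (simp add: on123_def)

lemma on123_on12: "on123 (on12 M) = on12 M"
  by (auto simp: fun_eq_iff)

lemma on123_on23: "on123 (on23 M) = on23 (on12 M)"
  by (auto simp: fun_eq_iff)

lemma row_finite_on12:
  assumes "row_finite M" shows "row_finite (on12 M :: (_ \<times> _ \<times> 'w, _) mat)"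
proof -
  have "finite {q. on12 M (x, y, z) q \<noteq> 0}" for x y and z :: 'w
  proof (rule finite_subset)
    show "{q. on12 M (x, y, z) q \<noteq> 0} \<subseteq> (\<lambda>(x', y'). (x', y', z)) ` {q. M (x, y) q \<noteq> 0}"
      by (auto split: if_splits intro: rev_image_eqI)
  qed (use assms in \<open>simp add: row_finite_def\<close>)
  thus ?thesis by (simp add: row_finite_def)
qed

lemma row_finite_on23:
  assumes "row_finite M" shows "row_finite (on23 M :: ('w \<times> _, _) mat)"
proof -
  have "finite {q. on23 M (x, p) q \<noteq> 0}" for x :: 'w and p
  proof (rule finite_subset)
    show "{q. on23 M (x, p) q \<noteq> 0} \<subseteq> Pair x ` {q. M p q \<noteq> 0}"
      by (auto split: if_splits)
    show "finite (Pair x ` {q. M p q \<noteq> 0})"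
      using assms unfolding row_finite_def by blast
  qed
  thus ?thesis unfolding row_finite_def by (metis surj_pair)
qed

lemma on12_mcomp: "(on12 (N \<odot> M) :: (_ \<times> _ \<times> 'w, _) mat) = on12 N \<odot> on12 M"
proof -
  have "(on12 N \<odot> on12 M) (x, y, z) (x', y', z') = (if z = z' then (N \<odot> M) (x, y) (x', y') else 0)"
    for x y x' y' and z z' :: 'w
  proof (cases "z = z'")
    case True
    have "(on12 N \<odot> on12 M) (x, y, z) (x', y', z') = (N \<odot> M) (x, y) (x', y')"
    proof (rule mcomp_reindex[where f = "\<lambda>(u, v). (u, v, z)"])
      show "j \<in> range (\<lambda>(u, v). (u, v, z))" if "on12 M (x, y, z) j \<noteq> 0" for j
        using that by (cases j) (auto split: if_splits)
    qed (auto simp: inj_on_def True)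
    thus ?thesis using True by simp
  next
    case False
    have "(on12 N \<odot> on12 M) (x, y, z) (x', y', z') = 0"
      by (rule ccontr, elim mcomp_nonzeroE) (use False in \<open>auto split: if_splits\<close>)
    thus ?thesis using False by simp
  qed
  thus ?thesis by (simp add: fun_eq_iff)
qed

lemma on23_mcomp: "(on23 (N \<odot> M) :: ('w \<times> _, _) mat) = on23 N \<odot> on23 M"
proof -
  have "(on23 N \<odot> on23 M) (x, p) (x', q) = (if x = x' then (N \<odot> M) p q else 0)" for x x' :: 'w and p q
  proof (cases "x = x'")
    case True
    have "(on23 N \<odot> on23 M) (x, p) (x', q) = (N \<odot> M) p q"
    proof (rule mcomp_reindex[where f = "Pair x"])
      show "j \<in> range (Pair x)" if "on23 M (x, p) j \<noteq> 0" for j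
        using that by (cases j) (auto split: if_splits)
    qed (auto simp: inj_on_def True)
    thus ?thesis using True by simp
  next
    case False
    have "(on23 N \<odot> on23 M) (x, p) (x', q) = 0"
      by (rule ccontr, elim mcomp_nonzeroE) (use False in \<open>auto split: if_splits\<close>)
    thus ?thesis using False by simp
  qed
  thus ?thesis by (simp add: fun_eq_iff)
qed

lemma on123_mcomp:
  "(on123 (N \<odot> M) :: (_ \<times> _ \<times> _ \<times> 'w, _) mat) = on123 N \<odot> on123 M"
proof -
  have "(on123 N \<odot> on123 M) (x, y, z, w) (x', y', z', w') =
      (if w = w' then (N \<odot> M) (x, y, z) (x', y', z') else 0)" for x y z x' y' z' and w w' :: 'w
  proof (cases "w = w'")
    case True
    have "(on123 N \<odot> on123 M) (x, y, z, w) (x', y', z', w') = (N \<odot> M) (x, y, z) (x', y', z')"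
    proof (rule mcomp_reindex[where f = "\<lambda>(u, v, t). (u, v, t, w)"])
      show "j \<in> range (\<lambda>(u, v, t). (u, v, t, w))" if "on123 M (x, y, z, w) j \<noteq> 0" for j
        using that by (cases j) (auto split: if_splits simp: image_iff)
    qed (auto simp: inj_on_def True)
    thus ?thesis using True by simp
  next
    case False
    have "(on123 N \<odot> on123 M) (x, y, z, w) (x', y', z', w') = 0"
      by (rule ccontr, elim mcomp_nonzeroE) (use False in \<open>auto split: if_splits\<close>)
    thus ?thesis using False by simp
  qed
  thus ?thesis by (simp add: fun_eq_iff)
qed

lemma on12_on34_commute: "on12 M \<odot> on23 (on23 N) = on23 (on23 N) \<odot> on12 M"
proof -
  have "(on12 M \<odot> on23 (on23 N)) (x, y, z, w) (x', y', z', w') =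
      (on23 (on23 N) \<odot> on12 M) (x, y, z, w) (x', y', z', w')" for x y z w x' y' z' w'
  proof -
    let ?p = "(x, y, z, w)" and ?q = "(x', y', z', w')"
    have "(on12 M \<odot> on23 (on23 N)) ?p ?q = on23 (on23 N) ?p (x, y, z', w') * on12 M (x, y, z', w') ?q"
      by (rule mcomp_single) (auto split: if_splits)
    moreover have "(on23 (on23 N) \<odot> on12 M) ?p ?q = on12 M ?p (x', y', z, w) * on23 (on23 N) (x', y', z, w) ?q"
      by (rule mcomp_single) (auto split: if_splits)
    ultimately show ?thesis by simp
  qed
  thus ?thesis by (simp add: fun_eq_iff)
qed


section \<open>Maps preserving endpoints of strings\<close>

text \<open>
  The finiteness that spaces of finite type and connecting sets have in common, in a form that
  is stable under tensor products.
\<close>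
definition locally_finite :: "('s, 't, 'x) lines \<Rightarrow> bool" where
  "locally_finite V \<longleftrightarrow>
     (\<forall>a. finite {x \<in> idx V. src V x = a}) \<and> (\<forall>b. finite {x \<in> idx V. tgt V x = b})"

text \<open>
  The condition of \<^term>\<open>Hom V W\<close> imposed on rows in \<^term>\<open>idx V\<close> only. The maps \<^term>\<open>on12 M\<close>
  and \<^term>\<open>on23 M\<close> do not test composability with the spectator, so they have this weaker
  property without being elements of \<^term>\<open>Hom V W\<close>.
\<close>
definition preserves :: "('s, 't, 'x) lines \<Rightarrow> ('s, 't, 'y) lines \<Rightarrow> ('x, 'y) mat \<Rightarrow> bool" where
  "preserves V W M \<longleftrightarrow> (\<forall>p q. p \<in> idx V \<longrightarrow> M p q \<noteq> 0 \<longrightarrow>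
     q \<in> idx W \<and> src W q = src V p \<and> tgt W q = tgt V p)"

lemma tensor_simps [simp]:
  "(x, y) \<in> idx (V \<otimes> W) \<longleftrightarrow> x \<in> idx V \<and> y \<in> idx W \<and> tgt V x = src W y"
  "src (V \<otimes> W) (x, y) = src V x" "tgt (V \<otimes> W) (x, y) = tgt W y"
  by (simp_all add: tensor_def)

lemma locally_finite_tensor:
  assumes V: "locally_finite V" and W: "locally_finite W"
  shows "locally_finite (V \<otimes> W)"
proof -
  have "finite {p \<in> idx (V \<otimes> W). src (V \<otimes> W) p = a}" for a
  proof (rule finite_subset)
    show "{p \<in> idx (V \<otimes> W). src (V \<otimes> W) p = a} \<subseteq>
        (SIGMA x:{x \<in> idx V. src V x = a}. {y \<in> idx W. src W y = tgt V x})"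
      by auto
  qed (use V W in \<open>auto simp: locally_finite_def\<close>)
  moreover have "finite {p \<in> idx (V \<otimes> W). tgt (V \<otimes> W) p = b}" for b
  proof (rule finite_subset)
    show "{p \<in> idx (V \<otimes> W). tgt (V \<otimes> W) p = b} \<subseteq>
        (\<lambda>(y, x). (x, y)) ` (SIGMA y:{y \<in> idx W. tgt W y = b}. {x \<in> idx V. tgt V x = src W y})"
      by (auto simp: image_iff)
  qed (use V W in \<open>auto simp: locally_finite_def\<close>)
  ultimately show ?thesis
    by (simp add: locally_finite_def)
qed

lemma finite_paths: "locally_finite V \<Longrightarrow> finite (paths V a b)"
  by (rule finite_subset[of _ "{x \<in> idx V. src V x = a}"]) (auto simp: paths_def locally_finite_def)

lemma HomD:
  assumes "M \<in> Hom V W" "M p q \<noteq> 0"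
  shows "p \<in> idx V" "q \<in> idx W" "src W q = src V p" "tgt W q = tgt V p"
  using assms by (auto simp: Hom_def)

lemma row_finite_Hom:
  assumes "M \<in> Hom V W" "locally_finite W"
  shows "row_finite M"
  unfolding row_finite_def
proof
  fix p
  have "{q. M p q \<noteq> 0} \<subseteq> paths W (src V p) (tgt V p)"
    using HomD[OF assms(1)] by (auto simp: paths_def)
  thus "finite {q. M p q \<noteq> 0}"
    by (rule finite_subset) (rule finite_paths[OF assms(2)])
qed

lemma preserves_Hom: "M \<in> Hom V W \<Longrightarrow> preserves V W M"
  by (auto simp: preserves_def dest: HomD)

lemma preserves_mcomp:
  assumes M: "preserves U V M" and N: "preserves V W N"
  shows "preserves U W (N \<odot> M)"
  unfolding preserves_def
proof (intro allI impI)
  fix p q assume p: "p \<in> idx U" and "(N \<odot> M) p q \<noteq> 0"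
  then obtain j where "M p j \<noteq> 0" "N j q \<noteq> 0" by (elim mcomp_nonzeroE)
  with p M N show "q \<in> idx W \<and> src W q = src U p \<and> tgt W q = tgt U p"
    unfolding preserves_def by metis
qed

lemma preserves_on12:
  assumes M: "preserves (V \<otimes> V') (W \<otimes> W') M"
  shows "preserves (V \<otimes> V' \<otimes> U) (W \<otimes> W' \<otimes> U) (on12 M)"
  unfolding preserves_def
proof (intro allI impI)
  fix p q assume p: "p \<in> idx (V \<otimes> V' \<otimes> U)" and nz: "on12 M p q \<noteq> 0"
  obtain x y z x' y' z' where pq: "p = (x, y, z)" "q = (x', y', z')" by (cases p; cases q)
  have "z' = z" "M (x, y) (x', y') \<noteq> 0" using nz by (auto simp: pq split: if_splits)
  with p M[unfolded preserves_def, rule_format, of "(x, y)" "(x', y')"]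
  show "q \<in> idx (W \<otimes> W' \<otimes> U) \<and> src (W \<otimes> W' \<otimes> U) q = src (V \<otimes> V' \<otimes> U) p \<and>
      tgt (W \<otimes> W' \<otimes> U) q = tgt (V \<otimes> V' \<otimes> U) p"
    by (simp add: pq)
qed

lemma preserves_on23:
  assumes M: "preserves V W M"
  shows "preserves (U \<otimes> V) (U \<otimes> W) (on23 M)"
  unfolding preserves_def
proof (intro allI impI)
  fix p q assume p: "p \<in> idx (U \<otimes> V)" and nz: "on23 M p q \<noteq> 0"
  obtain x y x' y' where pq: "p = (x, y)" "q = (x', y')" by (cases p; cases q)
  have "x' = x" "M y y' \<noteq> 0" using nz by (auto simp: pq split: if_splits)
  with p M[unfolded preserves_def, rule_format, of y y']
  show "q \<in> idx (U \<otimes> W) \<and> src (U \<otimes> W) q = src (U \<otimes> V) p \<and>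
      tgt (U \<otimes> W) q = tgt (U \<otimes> V) p"
    by (simp add: pq)
qed

lemma on12_mid_mcomp_row:
  assumes "\<And>x y z. M p (x, y, z) \<noteq> 0 \<Longrightarrow> (x, y) \<in> idx V"
  shows "(on12 (mid V) \<odot> M) p = M p"
proof -
  have "(on12 (mid V) \<odot> M) p (x, y, z) = M p (x, y, z)" for x y z
  proof -
    have "(on12 (mid V) \<odot> M) p (x, y, z) = M p (x, y, z) * on12 (mid V) (x, y, z) (x, y, z)"
      by (rule mcomp_single) (auto simp: mid_def split: if_splits)
    thus ?thesis
      using assms[of x y z] by (cases "M p (x, y, z) = 0") (auto simp: mid_def)
  qed
  thus ?thesis by (simp add: fun_eq_iff)
qed

lemma on23_mid_mcomp_row:
  assumes "\<And>x y. M p (x, y) \<noteq> 0 \<Longrightarrow> y \<in> idx V"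
  shows "(on23 (mid V) \<odot> M) p = M p"
proof -
  have "(on23 (mid V) \<odot> M) p (x, y) = M p (x, y)" for x y
  proof -
    have "(on23 (mid V) \<odot> M) p (x, y) = M p (x, y) * on23 (mid V) (x, y) (x, y)"
      by (rule mcomp_single) (auto simp: mid_def split: if_splits)
    thus ?thesis
      using assms[of x y] by (cases "M p (x, y) = 0") (auto simp: mid_def)
  qed
  thus ?thesis unfolding fun_eq_iff by (metis surj_pair)
qed

text \<open>
  The defining identities hold for each coefficient outside an exceptional set of its own. Between
  fixed endpoints there are finitely many strings, so finitely many exceptional sets suffice for
  all coefficients together, and an identity of operators can be used at a single generic point.
\<close>
lemma eventually_rows_on_paths:
  assumes V: "locally_finite V" and W: "locally_finite W"
    and M: "\<And>z. preserves V W (M z)" and N: "\<And>z. preserves V W (N z)"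
    and eq: "\<And>p q. p \<in> idx V \<Longrightarrow> eventually (\<lambda>z. M z p q = N z p q) F"
  shows "eventually (\<lambda>z. \<forall>p\<in>paths V a b. M z p = N z p) F"
proof (rule eventually_ball_finite[OF finite_paths[OF V]], intro ballI)
  fix p assume p: "p \<in> paths V a b"
  hence pV: "p \<in> idx V" by (simp add: paths_def)
  have "eventually (\<lambda>z. \<forall>q\<in>paths W a b. M z p q = N z p q) F"
    by (rule eventually_ball_finite[OF finite_paths[OF W]]) (use eq[OF pV] in auto)
  thus "eventually (\<lambda>z. M z p = N z p) F"
  proof eventually_elim
    case (elim z)
    show ?case
    proof
      fix q
      show "M z p q = N z p q"
      proof (cases "q \<in> paths W a b")
        case True thus ?thesis using elim by blast
      next
        case False
        have "M z p q = 0" "N z p q = 0"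
          using p False M[of z] N[of z] unfolding preserves_def paths_def by blast+
        thus ?thesis by simp
      qed
    qed
  qed
qed

section \<open>Relabelling of indices\<close>

lemma relabelledD:
  "relabelled \<phi> A \<psi> B M M' \<Longrightarrow> p \<in> A \<Longrightarrow> q \<in> B \<Longrightarrow> M' (\<phi> p) (\<psi> q) = M p q"
  by (simp add: relabelled_def)

text \<open>
  Giving an inverse \<open>\<psi>'\<close> of the relabelling explicitly lets each instance be checked by case
  distinction on the strings.
\<close>

lemma relabelledI:
  assumes "\<And>p q. p \<in> A \<Longrightarrow> q \<in> B \<Longrightarrow> M' (\<phi> p) (\<psi> q) = M p q"
    and "\<And>p q. p \<in> A \<Longrightarrow> M p q \<noteq> 0 \<Longrightarrow> q \<in> B"
    and "\<And>p q'. p \<in> A \<Longrightarrow> M' (\<phi> p) q' \<noteq> 0 \<Longrightarrow> \<psi>' q' \<in> B \<and> \<psi> (\<psi>' q') = q'"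
  shows "relabelled \<phi> A \<psi> B M M'"
  using assms unfolding relabelled_def by (metis image_eqI)


section \<open>Partial traces of conjugate operators\<close>

text \<open>
  A product of two partial traces is a partial trace of a product: the strings
  \<open>(\<alpha>, \<xi>, \<eta>) \<mapsto> (\<xi>, j, \<eta>) \<mapsto> (\<xi>, \<eta>, \<gamma>)\<close> that close up on \<open>(\<xi>, \<eta>)\<close> are parametrised by the loop \<open>j\<close>
  between the two factors.
\<close>
lemma partial_trace_mcomp:
  assumes M: "M \<in> Hom (V \<otimes> U) (U \<otimes> W)" and N: "N \<in> Hom (W \<otimes> U') (U' \<otimes> Y)"
    and \<alpha>: "\<alpha> \<in> paths V a a" and \<gamma>: "\<gamma> \<in> paths Y b b" and \<xi>\<eta>: "(\<xi>, \<eta>) \<in> paths (U \<otimes> U') a b"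
  shows "(partial_trace W U' Y N \<eta> \<odot> partial_trace V U W M \<xi>) \<alpha> \<gamma> =
      (on23 N \<odot> on12 M) (\<alpha>, \<xi>, \<eta>) (\<xi>, \<eta>, \<gamma>)"
proof (rule mcomp_reindex[symmetric, where f = "\<lambda>j. (\<xi>, j, \<eta>)"])
  show "inj (\<lambda>j. (\<xi>, j, \<eta>))" by (auto simp: inj_on_def)
next
  fix j
  have "M (\<alpha>, \<xi>) (\<xi>, j) = partial_trace V U W M \<xi> \<alpha> j"
    using HomD[OF M, of "(\<alpha>, \<xi>)" "(\<xi>, j)"] \<alpha> \<xi>\<eta>
    by (cases "M (\<alpha>, \<xi>) (\<xi>, j) = 0") (auto simp: partial_trace_def paths_def)
  moreover have "N (j, \<eta>) (\<eta>, \<gamma>) = partial_trace W U' Y N \<eta> j \<gamma>"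
    if "M (\<alpha>, \<xi>) (\<xi>, j) \<noteq> 0"
    using HomD[OF M that] HomD[OF N, of "(j, \<eta>)" "(\<eta>, \<gamma>)"] \<gamma> \<xi>\<eta>
    by (cases "N (j, \<eta>) (\<eta>, \<gamma>) = 0") (auto simp: partial_trace_def paths_def)
  ultimately show "on12 M (\<alpha>, \<xi>, \<eta>) (\<xi>, j, \<eta>) * on23 N (\<xi>, j, \<eta>) (\<xi>, \<eta>, \<gamma>) =
      partial_trace V U W M \<xi> \<alpha> j * partial_trace W U' Y N \<eta> j \<gamma>"
    by (cases "M (\<alpha>, \<xi>) (\<xi>, j) = 0") auto
next
  fix j assume "on12 M (\<alpha>, \<xi>, \<eta>) j \<noteq> 0" "on23 N j (\<xi>, \<eta>, \<gamma>) \<noteq> 0"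
  thus "j \<in> range (\<lambda>j. (\<xi>, j, \<eta>))" by (cases j) (auto split: if_splits)
qed

text \<open>
  Summing over \<open>(\<xi>, \<eta>)\<close> turns the convolution into the trace of \<open>N\<^sup>(\<^sup>2\<^sup>3\<^sup>) M\<^sup>(\<^sup>1\<^sup>2\<^sup>)\<close> over \<open>U \<otimes> U'\<close>.
\<close>
lemma convolution_partial_trace:
  assumes M: "M \<in> Hom (V \<otimes> U) (U \<otimes> W)" and N: "N \<in> Hom (W \<otimes> U') (U' \<otimes> Y)"
  shows "convolution U U' (partial_trace V U W M) (partial_trace W U' Y N) a b \<alpha> \<gamma> =
    (if \<alpha> \<in> paths V a a \<and> \<gamma> \<in> paths Y b b
     then \<Sum>(\<xi>, \<eta>)\<in>paths (U \<otimes> U') a b. (on23 N \<odot> on12 M) (\<alpha>, \<xi>, \<eta>) (\<xi>, \<eta>, \<gamma>) else 0)"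
proof (cases "\<alpha> \<in> paths V a a \<and> \<gamma> \<in> paths Y b b")
  case True
  thus ?thesis
    unfolding convolution_def by (auto intro!: sum.cong partial_trace_mcomp[OF M N])
next
  case False
  have "(partial_trace W U' Y N \<eta> \<odot> partial_trace V U W M \<xi>) \<alpha> \<gamma> = 0"
    if "(\<xi>, \<eta>) \<in> paths (U \<otimes> U') a b" for \<xi> \<eta>
    by (rule ccontr, elim mcomp_nonzeroE)
       (use False that in \<open>auto simp: partial_trace_def paths_def split: if_splits\<close>)
  thus ?thesis
    using False unfolding convolution_def by (auto intro!: sum.neutral)
qed

text \<open>
  Cyclicity of the trace. The traced factor \<open>A1 \<otimes> A2\<close> enters behind the first tensor factor and
  leaves in front of the last one, so \<open>C\<close> acts on it as \<open>C\<^sup>(\<^sup>2\<^sup>3\<^sup>)\<close> before \<open>X\<close> and its inverse as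
  \<open>D\<^sup>(\<^sup>1\<^sup>2\<^sup>)\<close> after \<open>X\<close>; under the trace they cancel.
\<close>
lemma partial_trace_cyclic:
  assumes C: "C \<in> Hom (A1 \<otimes> A2) (B1 \<otimes> B2)" and D: "D \<in> Hom (B1 \<otimes> B2) (A1 \<otimes> A2)"
    and CD: "C \<odot> D = mid (B1 \<otimes> B2)"
    and fin: "locally_finite (A1 \<otimes> A2)" "locally_finite (B1 \<otimes> B2)"
  shows "(\<Sum>(\<xi>, \<eta>)\<in>paths (A1 \<otimes> A2) a b. (on12 D \<odot> X \<odot> on23 C) (\<alpha>, \<xi>, \<eta>) (\<xi>, \<eta>, \<gamma>)) =
    (\<Sum>(\<xi>, \<eta>)\<in>paths (B1 \<otimes> B2) a b. X (\<alpha>, \<xi>, \<eta>) (\<xi>, \<eta>, \<gamma>))"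
proof -
  define P where "P = paths (A1 \<otimes> A2) a b"
  define Q where "Q = paths (B1 \<otimes> B2) a b"
  have finP: "finite P" and finQ: "finite Q"
    using fin by (simp_all add: P_def Q_def finite_paths)
  \<comment> \<open>\<open>E u v\<close> is the matrix entry of \<open>X\<close> from \<open>u\<close> to \<open>v\<close> as an operator on \<open>B1 \<otimes> B2\<close>.\<close>
  define E where "E u v = X (\<alpha>, u) (fst v, snd v, \<gamma>)" for u v
  have C_Q: "u \<in> Q" if "p \<in> P" "C p u \<noteq> 0" for p u
    using HomD[OF C that(2)] that(1) by (simp add: P_def Q_def paths_def)
  have D_Q: "v \<in> Q" if "p \<in> P" "D v p \<noteq> 0" for p v
    using HomD[OF D that(2)] that(1) by (simp add: P_def Q_def paths_def)
  have D_P: "p \<in> P" if "v \<in> Q" "D v p \<noteq> 0" for p v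
    using HomD[OF D that(2)] that(1) by (simp add: P_def Q_def paths_def)
  have XC: "(X \<odot> on23 C) (\<alpha>, p) (fst v, snd v, \<gamma>) = (\<Sum>u\<in>Q. C p u * E u v)" if p: "p \<in> P" for p v
  proof -
    have "(X \<odot> on23 C) (\<alpha>, p) (fst v, snd v, \<gamma>) =
        (\<Sum>j\<in>Pair \<alpha> ` Q. on23 C (\<alpha>, p) j * X j (fst v, snd v, \<gamma>))"
    proof (rule mcomp_eq_sum)
      fix j assume "on23 C (\<alpha>, p) j \<noteq> 0"
      thus "j \<in> Pair \<alpha> ` Q"
        using C_Q[OF p, of "snd j"] by (cases j) (auto split: if_splits)
    qed (simp add: finQ)
    thus ?thesis by (simp add: sum.reindex inj_on_def E_def)
  qed
  have entry: "(on12 D \<odot> X \<odot> on23 C) (\<alpha>, p) (fst p, snd p, \<gamma>) =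
      (\<Sum>v\<in>Q. \<Sum>u\<in>Q. E u v * (D v p * C p u))" if p: "p \<in> P" for p
  proof -
    let ?f = "\<lambda>v. (fst v, snd v, \<gamma>)"
    have "(on12 D \<odot> X \<odot> on23 C) (\<alpha>, p) (?f p) =
        (\<Sum>j\<in>?f ` Q. (X \<odot> on23 C) (\<alpha>, p) j * on12 D j (?f p))"
    proof (rule mcomp_eq_sum)
      fix j assume nz: "on12 D j (?f p) \<noteq> 0"
      obtain x y w where j: "j = (x, y, w)" by (cases j)
      have "w = \<gamma>" "(x, y) \<in> Q"
        using nz D_Q[OF p, of "(x, y)"] by (auto simp: j split: if_splits)
      thus "j \<in> ?f ` Q" using j by force
    qed (simp add: finQ)
    also have "\<dots> = (\<Sum>v\<in>Q. (X \<odot> on23 C) (\<alpha>, p) (?f v) * D v p)"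
      by (subst sum.reindex) (auto simp: inj_on_def prod_eq_iff)
    also have "\<dots> = (\<Sum>v\<in>Q. \<Sum>u\<in>Q. E u v * (D v p * C p u))"
      by (simp add: XC[OF p] sum_distrib_left sum_distrib_right mult_ac)
    finally show ?thesis .
  qed
  have "(\<Sum>p\<in>P. (on12 D \<odot> X \<odot> on23 C) (\<alpha>, p) (fst p, snd p, \<gamma>)) =
      (\<Sum>p\<in>P. \<Sum>v\<in>Q. \<Sum>u\<in>Q. E u v * (D v p * C p u))"
    by (intro sum.cong refl entry)
  also have "\<dots> = (\<Sum>v\<in>Q. \<Sum>u\<in>Q. \<Sum>p\<in>P. E u v * (D v p * C p u))"
    by (subst sum.swap, rule sum.cong[OF refl], rule sum.swap)
  also have "\<dots> = (\<Sum>v\<in>Q. \<Sum>u\<in>Q. E u v * (C \<odot> D) v u)"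
  proof (intro sum.cong refl)
    fix u v assume "v \<in> Q"
    hence "(C \<odot> D) v u = (\<Sum>p\<in>P. D v p * C p u)"
      by (intro mcomp_eq_sum[OF finP] D_P)
    thus "(\<Sum>p\<in>P. E u v * (D v p * C p u)) = E u v * (C \<odot> D) v u"
      by (simp add: sum_distrib_left)
  qed
  also have "\<dots> = (\<Sum>u\<in>Q. E u u)"
  proof (intro sum.cong refl)
    fix v assume v: "v \<in> Q"
    have "(\<Sum>u\<in>Q. E u v * (C \<odot> D) v u) = (\<Sum>u\<in>Q. if u = v then E v v else 0)"
      by (intro sum.cong refl) (use v in \<open>auto simp: CD mid_def Q_def paths_def\<close>)
    thus "(\<Sum>u\<in>Q. E u v * (C \<odot> D) v u) = E v v"
      using v finQ by simp
  qed
  finally show ?thesis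
    by (simp add: E_def P_def Q_def case_prod_unfold)
qed


section \<open>Triples and intertwiners as locally finite data\<close>

lemma (in is_groupoid) Inv_Inv:
  assumes "\<gamma> \<in> Arr G"
  shows "Inv G (Inv G \<gamma>) = \<gamma>"
proof -
  let ?i = "Inv G \<gamma>" and ?j = "Inv G (Inv G \<gamma>)"
  have i: "?i \<in> Arr G" "Src G ?i = Tgt G \<gamma>" "Tgt G ?i = Src G \<gamma>"
    using Inv_Arr[OF assms] by auto
  have j: "?j \<in> Arr G" "Src G ?j = Src G \<gamma>"
    using Inv_Arr[OF i(1)] i by auto
  have "?j = Comp G ?j (Comp G ?i \<gamma>)"
    using Comp_Idt[OF j(1)] Comp_Inv[OF assms] j by simp
  also have "\<dots> = Comp G (Comp G ?j ?i) \<gamma>"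
    using Comp_assoc[OF assms i(1) j(1)] i j by simp
  also have "\<dots> = \<gamma>"
    using Comp_Inv[OF i(1)] Comp_Idt[OF assms] i by simp
  finally show ?thesis .
qed

lemma space_of_simps [simp]:
  "idx (space_of T) = supp T" "src (space_of T) = Src (gpd T)" "tgt (space_of T) = Tgt (gpd T)"
  by (simp_all add: space_of_def)

lemma rmat_Hom:
  assumes "T \<in> symmetric_yb_triples"
  shows "rmat T z \<in> Hom (space_of T \<otimes> space_of T) (space_of T \<otimes> space_of T)"
  using assms by (simp add: symmetric_yb_triples_def yang_baxter_operator_def graded_End_def)

lemma supp_Src_Tgt:
  assumes "T \<in> symmetric_yb_triples" "\<alpha> \<in> supp T"
  shows "Src (gpd T) \<alpha> \<in> Ob (gpd T)" "Tgt (gpd T) \<alpha> \<in> Ob (gpd T)"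
proof -
  have "is_groupoid (gpd T)" "\<alpha> \<in> Arr (gpd T)"
    using assms by (auto simp: symmetric_yb_triples_def finite_type_space_def)
  thus "Src (gpd T) \<alpha> \<in> Ob (gpd T)" "Tgt (gpd T) \<alpha> \<in> Ob (gpd T)"
    by (rule is_groupoid.Src_Ob is_groupoid.Tgt_Ob)+
qed

lemma supp_Inv:
  assumes "T \<in> symmetric_yb_triples" "\<alpha> \<in> supp T"
  shows "Inv (gpd T) \<alpha> \<in> supp T" "Inv (gpd T) (Inv (gpd T) \<alpha>) = \<alpha>"
    "Src (gpd T) (Inv (gpd T) \<alpha>) = Tgt (gpd T) \<alpha>" "Tgt (gpd T) (Inv (gpd T) \<alpha>) = Src (gpd T) \<alpha>"
proof -
  have G: "is_groupoid (gpd T)" and fts: "finite_type_space T"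
    using assms by (auto simp: symmetric_yb_triples_def)
  have \<alpha>: "\<alpha> \<in> Arr (gpd T)" using fts assms by (auto simp: finite_type_space_def)
  show "Inv (gpd T) \<alpha> \<in> supp T" using fts \<alpha> assms by (auto simp: finite_type_space_def)
  show "Inv (gpd T) (Inv (gpd T) \<alpha>) = \<alpha>"
    "Src (gpd T) (Inv (gpd T) \<alpha>) = Tgt (gpd T) \<alpha>" "Tgt (gpd T) (Inv (gpd T) \<alpha>) = Src (gpd T) \<alpha>"
    using is_groupoid.Inv_Inv[OF G \<alpha>] is_groupoid.Inv_Arr[OF G \<alpha>] by auto
qed

lemma locally_finite_space_of:
  assumes "T \<in> symmetric_yb_triples"
  shows "locally_finite (space_of T)"
proof -
  have fin: "finite {\<alpha> \<in> supp T. Src (gpd T) \<alpha> = a \<or> Tgt (gpd T) \<alpha> = a}" for a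
  proof (cases "a \<in> Ob (gpd T)")
    case True
    thus ?thesis using assms by (auto simp: symmetric_yb_triples_def finite_type_space_def)
  next
    case False
    hence "{\<alpha> \<in> supp T. Src (gpd T) \<alpha> = a \<or> Tgt (gpd T) \<alpha> = a} = {}"
      using supp_Src_Tgt[OF assms] by blast
    thus ?thesis by (simp only: finite.emptyI)
  qed
  show ?thesis
    unfolding locally_finite_def by (auto intro: finite_subset[OF _ fin])
qed

text \<open>
  The definition bounds the fibres over objects; over all other points the fibres are empty.
\<close>
lemma locally_finite_connecting_set:
  assumes "connecting_set G1 G2 K"
  shows "locally_finite K"
proof -
  have "finite {x \<in> idx K. src K x = a}" for a
  proof (cases "a \<in> Ob G1")
    case False
    hence "{x \<in> idx K. src K x = a} = {}" using assms by (auto simp: connecting_set_def)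
    thus ?thesis by (simp only: finite.emptyI)
  qed (use assms in \<open>simp add: connecting_set_def\<close>)
  moreover have "finite {x \<in> idx K. tgt K x = b}" for b
  proof (cases "b \<in> Ob G2")
    case False
    hence "{x \<in> idx K. tgt K x = b} = {}" using assms by (auto simp: connecting_set_def)
    thus ?thesis by (simp only: finite.emptyI)
  qed (use assms in \<open>simp add: connecting_set_def\<close>)
  ultimately show ?thesis by (simp add: locally_finite_def)
qed

lemma intertwinerD:
  assumes "intertwiner T1 T2 K C"
  shows "connecting_set (gpd T1) (gpd T2) K" "locally_finite K"
    "C \<in> Hom (space_of T1 \<otimes> K) (K \<otimes> space_of T2)"
  using assms locally_finite_connecting_set by (auto simp: intertwiner_def)

lemma invertible_intertwinerE:
  assumes "invertible_intertwiner T1 T2 K C"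
  obtains D where "intertwiner T1 T2 K C" "D \<in> Hom (K \<otimes> space_of T2) (space_of T1 \<otimes> K)"
    "D \<odot> C = mid (space_of T1 \<otimes> K)" "C \<odot> D = mid (K \<otimes> space_of T2)"
  using assms by (auto simp: invertible_intertwiner_def)

lemma intertwiner_preserves:
  assumes T1: "T1 \<in> symmetric_yb_triples" and T2: "T2 \<in> symmetric_yb_triples"
    and C: "C \<in> Hom (space_of T1 \<otimes> K) (K \<otimes> space_of T2)"
  shows "preserves (space_of T1 \<otimes> space_of T1 \<otimes> K) (K \<otimes> space_of T2 \<otimes> space_of T2)
      (on12 C \<odot> on23 C \<odot> on12 (rmat T1 z))"
    and "preserves (space_of T1 \<otimes> space_of T1 \<otimes> K) (K \<otimes> space_of T2 \<otimes> space_of T2)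
      (on23 (rmat T2 z) \<odot> on12 C \<odot> on23 C)"
  by (rule preserves_mcomp preserves_on12 preserves_on23 preserves_Hom[OF C]
      preserves_Hom[OF rmat_Hom[OF T1]] preserves_Hom[OF rmat_Hom[OF T2]])+

lemma eventually_intertwines:
  assumes T1: "T1 \<in> symmetric_yb_triples" and T2: "T2 \<in> symmetric_yb_triples"
    and C: "intertwiner T1 T2 K C"
  shows "\<forall>\<^sub>\<approx>z. \<forall>p\<in>paths (space_of T1 \<otimes> space_of T1 \<otimes> K) a b.
    (on12 C \<odot> on23 C \<odot> on12 (rmat T1 z)) p = (on23 (rmat T2 z) \<odot> on12 C \<odot> on23 C) p"
proof (rule eventually_rows_on_paths)
  note lf = locally_finite_tensor locally_finite_space_of[OF T1] locally_finite_space_of[OF T2]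
    intertwinerD(2)[OF C]
  show "locally_finite (space_of T1 \<otimes> space_of T1 \<otimes> K)"
    "locally_finite (K \<otimes> space_of T2 \<otimes> space_of T2)"
    by (intro lf)+
  show "preserves (space_of T1 \<otimes> space_of T1 \<otimes> K) (K \<otimes> space_of T2 \<otimes> space_of T2)
      (on12 C \<odot> on23 C \<odot> on12 (rmat T1 z))"
    "preserves (space_of T1 \<otimes> space_of T1 \<otimes> K) (K \<otimes> space_of T2 \<otimes> space_of T2)
      (on23 (rmat T2 z) \<odot> on12 C \<odot> on23 C)" for z
    by (rule intertwiner_preserves[OF T1 T2 intertwinerD(3)[OF C]])+
qed (use C in \<open>unfold intertwiner_def, blast\<close>)


section \<open>The trace identity\<close>

text \<open>
  The left side is the trace over \<open>V\<^sup>\<pi>\<^sup>1 \<otimes> V\<^sup>\<pi>\<close> of \<open>C\<^sup>(\<^sup>2\<^sup>3\<^sup>) R\<^sub>1\<^sup>(\<^sup>1\<^sup>2\<^sup>)\<close>, the right side the trace over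
  \<open>V\<^sup>\<pi> \<otimes> V\<^sup>\<pi>\<^sup>2\<close> of \<open>R\<^sub>2\<^sup>(\<^sup>2\<^sup>3\<^sup>) C\<^sup>(\<^sup>1\<^sup>2\<^sup>)\<close>. Multiplying the intertwining relation by the inverse of \<open>C\<^sup>(\<^sup>1\<^sup>2\<^sup>)\<close>
  exhibits the first operator as the conjugate of the second by \<open>C\<close>, and the trace is cyclic.
\<close>
lemma convolution_partial_traces_eq:
  assumes T1: "T1 \<in> symmetric_yb_triples" and T2: "T2 \<in> symmetric_yb_triples"
    and C: "invertible_intertwiner T1 T2 K C"
  shows "\<forall>\<^sub>\<approx>z. convolution (space_of T1) K
             (partial_trace (space_of T1) (space_of T1) (space_of T1) (rmat T1 z))
             (partial_trace (space_of T1) K (space_of T2) C) a b =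
           convolution K (space_of T2)
             (partial_trace (space_of T1) K (space_of T2) C)
             (partial_trace (space_of T2) (space_of T2) (space_of T2) (rmat T2 z)) a b"
proof -
  obtain D where I: "intertwiner T1 T2 K C" and D: "D \<in> Hom (K \<otimes> space_of T2) (space_of T1 \<otimes> K)"
    and DC: "D \<odot> C = mid (space_of T1 \<otimes> K)" and CD: "C \<odot> D = mid (K \<otimes> space_of T2)"
    using C by (elim invertible_intertwinerE)
  note K = intertwinerD[OF I]
  note R1 = rmat_Hom[OF T1] and R2 = rmat_Hom[OF T2]
  note lf = locally_finite_tensor locally_finite_space_of[OF T1] locally_finite_space_of[OF T2] K(2)
  have rf: "row_finite C" "row_finite D" "row_finite (rmat T1 z)" "row_finite (rmat T2 z)" for z
    by (rule row_finite_Hom[OF K(3)] row_finite_Hom[OF D] row_finite_Hom[OF R1] row_finite_Hom[OF R2];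
        intro lf)+
  note rfs = row_finite_mcomp row_finite_on12 row_finite_on23 rf
  show ?thesis
    using eventually_intertwines[OF T1 T2 I, of a b]
  proof eventually_elim
    case (elim z)
    let ?R1 = "on12 (rmat T1 z)" and ?X = "on23 (rmat T2 z) \<odot> on12 C"
    have Y: "preserves (space_of T1 \<otimes> space_of T1 \<otimes> K) (space_of T1 \<otimes> K \<otimes> space_of T2)
        (on23 C \<odot> ?R1)"
      by (rule preserves_mcomp preserves_on12 preserves_on23 preserves_Hom[OF K(3)] preserves_Hom[OF R1])+
    \<comment> \<open>Inserting \<open>D\<^sup>(\<^sup>1\<^sup>2\<^sup>) C\<^sup>(\<^sup>1\<^sup>2\<^sup>) = 1\<close> on the left makes the intertwining relation applicable.\<close>
    have conj: "(on23 C \<odot> ?R1) p = (on12 D \<odot> ?X \<odot> on23 C) p"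
      if p: "p \<in> paths (space_of T1 \<otimes> space_of T1 \<otimes> K) a b" for p
    proof -
      have "(on23 C \<odot> ?R1) p = (on12 (mid (space_of T1 \<otimes> K)) \<odot> on23 C \<odot> ?R1) p"
      proof (rule on12_mid_mcomp_row[symmetric])
        fix x y w assume "(on23 C \<odot> ?R1) p (x, y, w) \<noteq> 0"
        with Y p have "(x, y, w) \<in> idx (space_of T1 \<otimes> K \<otimes> space_of T2)"
          unfolding preserves_def paths_def by blast
        thus "(x, y) \<in> idx (space_of T1 \<otimes> K)" by simp
      qed
      also have "\<dots> = (on12 D \<odot> on12 C \<odot> on23 C \<odot> ?R1) p"
        unfolding DC[symmetric] on12_mcomp by (subst mcomp_assoc) (intro rfs refl)+
      also have "\<dots> = (on12 D \<odot> on23 (rmat T2 z) \<odot> on12 C \<odot> on23 C) p"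
        by (rule mcomp_cong_row) (use elim p in blast)
      also have "\<dots> = (on12 D \<odot> ?X \<odot> on23 C) p"
        by (subst mcomp_assoc) (intro rfs refl)+
      finally show ?thesis .
    qed
    show ?case
    proof (intro ext)
      fix \<alpha> \<gamma>
      show "convolution (space_of T1) K
             (partial_trace (space_of T1) (space_of T1) (space_of T1) (rmat T1 z))
             (partial_trace (space_of T1) K (space_of T2) C) a b \<alpha> \<gamma> =
           convolution K (space_of T2)
             (partial_trace (space_of T1) K (space_of T2) C)
             (partial_trace (space_of T2) (space_of T2) (space_of T2) (rmat T2 z)) a b \<alpha> \<gamma>"
      proof (cases "\<alpha> \<in> paths (space_of T1) a a \<and> \<gamma> \<in> paths (space_of T2) b b")
        case True
        have "(\<Sum>(\<xi>, \<eta>)\<in>paths (space_of T1 \<otimes> K) a b. (on23 C \<odot> ?R1) (\<alpha>, \<xi>, \<eta>) (\<xi>, \<eta>, \<gamma>)) =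
            (\<Sum>(\<xi>, \<eta>)\<in>paths (space_of T1 \<otimes> K) a b. (on12 D \<odot> ?X \<odot> on23 C) (\<alpha>, \<xi>, \<eta>) (\<xi>, \<eta>, \<gamma>))"
        proof (intro sum.cong refl, clarify)
          fix \<xi> \<eta> assume "(\<xi>, \<eta>) \<in> paths (space_of T1 \<otimes> K) a b"
          hence "(\<alpha>, \<xi>, \<eta>) \<in> paths (space_of T1 \<otimes> space_of T1 \<otimes> K) a b"
            using True by (auto simp: paths_def)
          from conj[OF this] show "(on23 C \<odot> ?R1) (\<alpha>, \<xi>, \<eta>) (\<xi>, \<eta>, \<gamma>) =
              (on12 D \<odot> ?X \<odot> on23 C) (\<alpha>, \<xi>, \<eta>) (\<xi>, \<eta>, \<gamma>)" by simp
        qed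
        also have "\<dots> = (\<Sum>(\<xi>, \<eta>)\<in>paths (K \<otimes> space_of T2) a b. ?X (\<alpha>, \<xi>, \<eta>) (\<xi>, \<eta>, \<gamma>))"
          by (rule partial_trace_cyclic[OF K(3) D CD]) (intro lf)+
        finally show ?thesis
          using True by (simp add: convolution_partial_trace[OF R1 K(3)] convolution_partial_trace[OF K(3) R2])
      next
        case False
        thus ?thesis
          by (simp only: if_False convolution_partial_trace[OF R1 K(3)] convolution_partial_trace[OF K(3) R2])
      qed
    qed
  qed
qed

section \<open>Reflexivity\<close>

text \<open>
  The intertwiner is the unit: the connecting set consists of the objects, each being its own
  source and target, and \<open>C\<close> identifies \<open>V\<^sub>\<alpha> \<otimes> \<complex>\<close> at the target of \<open>\<alpha>\<close> with \<open>\<complex> \<otimes> V\<^sub>\<alpha>\<close> at its source.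
\<close>
lemma yb_equivalent_refl:
  assumes T: "T \<in> symmetric_yb_triples"
  shows "yb_equivalent T T"
proof -
  define K where "K = \<lparr> idx = Ob (gpd T), src = \<lambda>a. a, tgt = \<lambda>a. a \<rparr>"
  let ?V = "space_of T" and ?s = "Src (gpd T)" and ?t = "Tgt (gpd T)"
  have K_simps [simp]: "idx K = Ob (gpd T)" "src K a = a" "tgt K a = a" for a
    by (simp_all add: K_def)
  define C where "C = (\<lambda>(\<alpha>, k) (k', \<gamma>).
    if \<alpha> = \<gamma> \<and> \<alpha> \<in> supp T \<and> k = ?t \<alpha> \<and> k' = ?s \<alpha> then 1 else 0 :: complex)"
  define D where "D = (\<lambda>p q. C q p)"
  note R = rmat_Hom[OF T] and st = supp_Src_Tgt[OF T]
  have C_simp [simp]: "C (\<alpha>, k) (k', \<gamma>) =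
      (if \<alpha> = \<gamma> \<and> \<alpha> \<in> supp T \<and> k = ?t \<alpha> \<and> k' = ?s \<alpha> then 1 else 0)" for \<alpha> k k' \<gamma>
    by (simp add: C_def)
  have D_simp [simp]: "D (k', \<gamma>) (\<alpha>, k) =
      (if \<alpha> = \<gamma> \<and> \<alpha> \<in> supp T \<and> k = ?t \<alpha> \<and> k' = ?s \<alpha> then 1 else 0)" for \<alpha> k k' \<gamma>
    by (simp add: D_def)
  have C: "C \<in> Hom (?V \<otimes> K) (K \<otimes> ?V)" and D: "D \<in> Hom (K \<otimes> ?V) (?V \<otimes> K)"
    by (auto simp: Hom_def st split: if_splits)
  have DC: "D \<odot> C = mid (?V \<otimes> K)"
  proof -
    have "(D \<odot> C) (\<alpha>, k) (\<gamma>, l) = mid (?V \<otimes> K) (\<alpha>, k) (\<gamma>, l)" for \<alpha> k \<gamma> l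
    proof -
      have "(D \<odot> C) (\<alpha>, k) (\<gamma>, l) = C (\<alpha>, k) (?s \<alpha>, \<alpha>) * D (?s \<alpha>, \<alpha>) (\<gamma>, l)"
      proof (rule mcomp_single)
        show "j = (?s \<alpha>, \<alpha>)" if "C (\<alpha>, k) j \<noteq> 0" for j
          using that by (cases j) (simp split: if_splits)
      qed
      also have "\<dots> = mid (?V \<otimes> K) (\<alpha>, k) (\<gamma>, l)"
        using st(2)[of \<alpha>] by (cases "\<alpha> \<in> supp T"; cases "k = ?t \<alpha>") (auto simp: mid_def)
      finally show ?thesis .
    qed
    thus ?thesis by (simp add: fun_eq_iff)
  qed
  have CD: "C \<odot> D = mid (K \<otimes> ?V)"
  proof -
    have "(C \<odot> D) (k, \<alpha>) (l, \<gamma>) = mid (K \<otimes> ?V) (k, \<alpha>) (l, \<gamma>)" for \<alpha> k \<gamma> l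
    proof -
      have "(C \<odot> D) (k, \<alpha>) (l, \<gamma>) = D (k, \<alpha>) (\<alpha>, ?t \<alpha>) * C (\<alpha>, ?t \<alpha>) (l, \<gamma>)"
      proof (rule mcomp_single)
        show "j = (\<alpha>, ?t \<alpha>)" if "D (k, \<alpha>) j \<noteq> 0" for j
          using that by (cases j) (simp split: if_splits)
      qed
      also have "\<dots> = mid (K \<otimes> ?V) (k, \<alpha>) (l, \<gamma>)"
        using st(1)[of \<alpha>] by (cases "\<alpha> \<in> supp T"; cases "k = ?s \<alpha>") (auto simp: mid_def)
      finally show ?thesis .
    qed
    thus ?thesis by (simp add: fun_eq_iff)
  qed
  have conn: "connecting_set (gpd T) (gpd T) K"
    unfolding connecting_set_def by (simp add: Collect_conv_if)
  \<comment> \<open>Passing the unit line through two factors only moves its label from the end of the string to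
    the beginning, which commutes with \<open>R\<close> because \<open>R\<close> preserves endpoints.\<close>
  have S: "(on12 C \<odot> on23 C) (x, y, l) j =
      (if (x, y, l) \<in> idx (?V \<otimes> ?V \<otimes> K) \<and> j = (?s x, x, y) then 1 else 0)" for x y l j
  proof -
    have "(on12 C \<odot> on23 C) (x, y, l) j = on23 C (x, y, l) (x, ?s y, y) * on12 C (x, ?s y, y) j"
      by (rule mcomp_single) (auto split: if_splits)
    also have "\<dots> = (if (x, y, l) \<in> idx (?V \<otimes> ?V \<otimes> K) \<and> j = (?s x, x, y) then 1 else 0)"
      using st(2)[of y] by (cases j; cases "y \<in> supp T"; cases "l = ?t y") auto
    finally show ?thesis .
  qed
  have rf: "row_finite C" "row_finite (rmat T z)" for z
    by (rule row_finite_Hom[OF C] row_finite_Hom[OF R];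
        intro locally_finite_tensor locally_finite_space_of[OF T] locally_finite_connecting_set[OF conn])+
  have "(on12 C \<odot> on23 C \<odot> on12 (rmat T z)) p q = (on23 (rmat T z) \<odot> on12 C \<odot> on23 C) p q"
    if p: "p \<in> idx (?V \<otimes> ?V \<otimes> K)" for p q z
  proof -
    obtain \<alpha> \<beta> k m \<gamma> \<delta> where pq: "p = (\<alpha>, \<beta>, k)" "q = (m, \<gamma>, \<delta>)" by (cases p; cases q)
    have "(on12 C \<odot> on23 C \<odot> on12 (rmat T z)) p q = ((on12 C \<odot> on23 C) \<odot> on12 (rmat T z)) p q"
      by (subst mcomp_assoc) (intro row_finite_on12 row_finite_on23 rf refl)+
    also have "\<dots> = on12 (rmat T z) p (\<gamma>, \<delta>, k) * (on12 C \<odot> on23 C) (\<gamma>, \<delta>, k) q"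
      by (rule mcomp_single) (auto simp: pq S split: if_splits)
    also have "\<dots> = (if m = ?s \<alpha> then rmat T z (\<alpha>, \<beta>) (\<gamma>, \<delta>) else 0)"
      using p HomD[OF R, of z "(\<alpha>, \<beta>)" "(\<gamma>, \<delta>)"]
      by (cases "rmat T z (\<alpha>, \<beta>) (\<gamma>, \<delta>) = 0") (auto simp: pq S st)
    also have "\<dots> = (on12 C \<odot> on23 C) p (?s \<alpha>, \<alpha>, \<beta>) * on23 (rmat T z) (?s \<alpha>, \<alpha>, \<beta>) q"
      using p by (simp add: pq S)
    also have "\<dots> = (on23 (rmat T z) \<odot> on12 C \<odot> on23 C) p q"
      by (rule mcomp_single[symmetric]) (auto simp: pq S split: if_splits)
    finally show ?thesis .
  qed
  hence "intertwiner T T K C"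
    unfolding intertwiner_def using conn C by (intro conjI ballI allI always_eventually)
  hence "invertible_intertwiner T T K C"
    unfolding invertible_intertwiner_def using D DC CD by blast
  thus ?thesis by (rule yb_equivalentI)
qed


section \<open>Transitivity\<close>

lemma Hom_mcomp:
  assumes M: "M \<in> Hom U V" and N: "N \<in> Hom V W"
  shows "N \<odot> M \<in> Hom U W"
  unfolding Hom_def
proof (intro CollectI allI impI)
  fix p q assume "(N \<odot> M) p q \<noteq> 0"
  then obtain j where "M p j \<noteq> 0" "N j q \<noteq> 0" by (elim mcomp_nonzeroE)
  from HomD[OF M this(1)] HomD[OF N this(2)]
  show "p \<in> idx U \<and> q \<in> idx W \<and> src U p = src W q \<and> tgt U p = tgt W q" by simp
qed

text \<open>
  Although \<^term>\<open>on12 M\<close> alone does not test composability with its spectator, a nonzero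
  coefficient of the product forces it: \<open>N\<close> then acts on the spectator together with a factor
  that has the same target as the one replaced by \<open>M\<close>.
\<close>
lemma on23_on12_Hom:
  assumes M: "M \<in> Hom (V \<otimes> K) (K \<otimes> W)" and N: "N \<in> Hom (W \<otimes> L) (L \<otimes> Y)"
  shows "on23 N \<odot> on12 M \<in> Hom (V \<otimes> K \<otimes> L) (K \<otimes> L \<otimes> Y)"
  unfolding Hom_def
proof (intro CollectI allI impI)
  fix p q assume "(on23 N \<odot> on12 M) p q \<noteq> 0"
  then obtain j where nz: "on12 M p j \<noteq> 0" "on23 N j q \<noteq> 0" by (elim mcomp_nonzeroE)
  obtain x y z x' y' z' u v w where eqs: "p = (x, y, z)" "q = (x', y', z')" "j = (u, v, w)"
    by (cases p; cases q; cases j)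
  have "M (x, y) (x', v) \<noteq> 0" "N (v, z) (y', z') \<noteq> 0"
    using nz by (auto simp: eqs split: if_splits)
  from HomD[OF M this(1)] HomD[OF N this(2)]
  show "p \<in> idx (V \<otimes> K \<otimes> L) \<and> q \<in> idx (K \<otimes> L \<otimes> Y) \<and>
      src (V \<otimes> K \<otimes> L) p = src (K \<otimes> L \<otimes> Y) q \<and> tgt (V \<otimes> K \<otimes> L) p = tgt (K \<otimes> L \<otimes> Y) q"
    by (simp add: eqs)
qed

lemma on12_on23_Hom:
  assumes M: "M \<in> Hom (K \<otimes> W) (V \<otimes> K)" and N: "N \<in> Hom (L \<otimes> Y) (W \<otimes> L)"
  shows "on12 M \<odot> on23 N \<in> Hom (K \<otimes> L \<otimes> Y) (V \<otimes> K \<otimes> L)"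
  unfolding Hom_def
proof (intro CollectI allI impI)
  fix p q assume "(on12 M \<odot> on23 N) p q \<noteq> 0"
  then obtain j where nz: "on23 N p j \<noteq> 0" "on12 M j q \<noteq> 0" by (elim mcomp_nonzeroE)
  obtain x y z x' y' z' u v w where eqs: "p = (x, y, z)" "q = (x', y', z')" "j = (u, v, w)"
    by (cases p; cases q; cases j)
  have "N (y, z) (v, z') \<noteq> 0" "M (x, v) (x', y') \<noteq> 0"
    using nz by (auto simp: eqs split: if_splits)
  from HomD[OF N this(1)] HomD[OF M this(2)]
  show "p \<in> idx (K \<otimes> L \<otimes> Y) \<and> q \<in> idx (V \<otimes> K \<otimes> L) \<and>
      src (K \<otimes> L \<otimes> Y) p = src (V \<otimes> K \<otimes> L) q \<and> tgt (K \<otimes> L \<otimes> Y) p = tgt (V \<otimes> K \<otimes> L) q"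
    by (simp add: eqs)
qed

lemma mid_eqI:
  assumes "P \<in> Hom V W" "\<And>p. p \<in> idx V \<Longrightarrow> P p = mid V p"
  shows "P = mid V"
proof (intro ext)
  fix p q
  show "P p q = mid V p q"
    using assms HomD(1)[OF assms(1), of p q] by (cases "p \<in> idx V") (auto simp: mid_def)
qed

text \<open>
  On composable strings the identity of two of the factors is the identity. On other strings these
  matrices may differ, whence the restriction on the rows.
\<close>
lemma on12_mid: "p \<in> idx (V \<otimes> K \<otimes> L) \<Longrightarrow> on12 (mid (V \<otimes> K)) p = mid (V \<otimes> K \<otimes> L) p"
  by (cases p) (auto simp: fun_eq_iff mid_def)

lemma on23_mid: "p \<in> idx (V \<otimes> K) \<Longrightarrow> on23 (mid K) p = mid (V \<otimes> K) p"
  by (cases p) (auto simp: fun_eq_iff mid_def)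

lemma consecutive_inverse:
  assumes C: "C \<in> Hom (V \<otimes> K) (K \<otimes> W)" and D: "D \<in> Hom (K \<otimes> W) (V \<otimes> K)"
    and C': "C' \<in> Hom (W \<otimes> L) (L \<otimes> Y)" and D': "D' \<in> Hom (L \<otimes> Y) (W \<otimes> L)"
    and rf: "row_finite C" "row_finite D" "row_finite C'" "row_finite D'"
  shows "D \<odot> C = mid (V \<otimes> K) \<Longrightarrow> D' \<odot> C' = mid (W \<otimes> L) \<Longrightarrow>
      (on12 D \<odot> on23 D') \<odot> on23 C' \<odot> on12 C = mid (V \<otimes> K \<otimes> L)"
    and "C \<odot> D = mid (K \<otimes> W) \<Longrightarrow> C' \<odot> D' = mid (L \<otimes> Y) \<Longrightarrow>
      (on23 C' \<odot> on12 C) \<odot> on12 D \<odot> on23 D' = mid (K \<otimes> L \<otimes> Y)"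
proof -
  note rfs = row_finite_mcomp row_finite_on12 row_finite_on23 rf
  note Homs = on23_on12_Hom[OF C C'] on12_on23_Hom[OF D D']
  show "(on12 D \<odot> on23 D') \<odot> on23 C' \<odot> on12 C = mid (V \<otimes> K \<otimes> L)"
    if DC: "D \<odot> C = mid (V \<otimes> K)" and D'C': "D' \<odot> C' = mid (W \<otimes> L)"
  proof (rule mid_eqI[OF Hom_mcomp[OF Homs]])
    fix p assume p: "p \<in> idx (V \<otimes> K \<otimes> L)"
    have "((on12 D \<odot> on23 D') \<odot> on23 C' \<odot> on12 C) p = (on12 D \<odot> on23 (D' \<odot> C') \<odot> on12 C) p"
      by (simp add: on23_mcomp mcomp_assoc rfs)
    also have "\<dots> = (on12 D \<odot> on12 C) p"
      unfolding D'C'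
    proof (intro mcomp_cong_row on23_mid_mcomp_row)
      fix x y assume "on12 C p (x, y) \<noteq> 0"
      with p preserves_on12[OF preserves_Hom[OF C]] have "(x, y) \<in> idx (K \<otimes> W \<otimes> L)"
        unfolding preserves_def by blast
      thus "y \<in> idx (W \<otimes> L)" by simp
    qed
    also have "\<dots> = mid (V \<otimes> K \<otimes> L) p"
      by (simp only: on12_mcomp[symmetric] DC on12_mid[OF p])
    finally show "((on12 D \<odot> on23 D') \<odot> on23 C' \<odot> on12 C) p = mid (V \<otimes> K \<otimes> L) p" .
  qed
  show "(on23 C' \<odot> on12 C) \<odot> on12 D \<odot> on23 D' = mid (K \<otimes> L \<otimes> Y)"
    if CD: "C \<odot> D = mid (K \<otimes> W)" and C'D': "C' \<odot> D' = mid (L \<otimes> Y)"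
  proof (rule mid_eqI[OF Hom_mcomp[OF Homs(2,1)]])
    fix p assume p: "p \<in> idx (K \<otimes> L \<otimes> Y)"
    have "((on23 C' \<odot> on12 C) \<odot> on12 D \<odot> on23 D') p = (on23 C' \<odot> on12 (C \<odot> D) \<odot> on23 D') p"
      by (simp add: on12_mcomp mcomp_assoc rfs)
    also have "\<dots> = (on23 C' \<odot> on23 D') p"
      unfolding CD
    proof (intro mcomp_cong_row on12_mid_mcomp_row)
      fix x y z assume "on23 D' p (x, y, z) \<noteq> 0"
      with p preserves_on23[OF preserves_Hom[OF D']] have "(x, y, z) \<in> idx (K \<otimes> W \<otimes> L)"
        unfolding preserves_def by blast
      thus "(x, y) \<in> idx (K \<otimes> W)" by simp
    qed
    also have "\<dots> = mid (K \<otimes> L \<otimes> Y) p"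
      by (simp only: on23_mcomp[symmetric] C'D' on23_mid[OF p])
    finally show "((on23 C' \<odot> on12 C) \<odot> on12 D \<odot> on23 D') p = mid (K \<otimes> L \<otimes> Y) p" .
  qed
qed

lemma on12_on34_commute_left:
  assumes "row_finite M" "row_finite N" "row_finite X"
  shows "on12 M \<odot> on23 (on23 N) \<odot> X = on23 (on23 N) \<odot> on12 M \<odot> X"
proof -
  have "(on12 M \<odot> on23 (on23 N)) \<odot> X = (on23 (on23 N) \<odot> on12 M) \<odot> X"
    by (simp only: on12_on34_commute)
  thus ?thesis
    using assms by (simp add: mcomp_assoc row_finite_on12 row_finite_on23)
qed

text \<open>
  Passing two copies of \<open>V\<^sup>\<pi>\<^sup>1\<close> first through \<open>K\<close> and then through \<open>L\<close>. The operators \<open>C\<^sup>(\<^sup>1\<^sup>2\<^sup>)\<close> and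
  \<open>C'\<^sup>(\<^sup>3\<^sup>4\<^sup>)\<close> commute, so both copies may cross \<open>K\<close> before either crosses \<open>L\<close>. This turns
  \<open>R\<^sub>1\<^sup>(\<^sup>1\<^sup>2\<^sup>)\<close> into \<open>R\<^sub>2\<^sup>(\<^sup>2\<^sup>3\<^sup>)\<close> by the first relation and then into \<open>R\<^sub>3\<^sup>(\<^sup>3\<^sup>4\<^sup>)\<close> by the second one.
\<close>
lemma consecutive_intertwines:
  fixes T1 :: "('o1, 'a1) triple" and T2 :: "('o2, 'a2) triple" and T3 :: "('o3, 'a3) triple"
    and K :: "('o1, 'o2, 'c) lines" and L :: "('o2, 'o3, 'd) lines"
  assumes T1: "T1 \<in> symmetric_yb_triples" and T2: "T2 \<in> symmetric_yb_triples"
    and T3: "T3 \<in> symmetric_yb_triples"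
    and C: "intertwiner T1 T2 K C" and C': "intertwiner T2 T3 L C'"
    and p: "p \<in> idx (space_of T1 \<otimes> space_of T1 \<otimes> K \<otimes> L)"
  shows "\<forall>\<^sub>\<approx>z. (on123 (on23 C' \<odot> on12 C) \<odot> on23 (on23 C' \<odot> on12 C) \<odot> on12 (rmat T1 z)) p =
      (on23 (on23 (rmat T3 z)) \<odot> on123 (on23 C' \<odot> on12 C) \<odot> on23 (on23 C' \<odot> on12 C)) p"
proof -
  let ?V1 = "space_of T1" and ?V2 = "space_of T2" and ?V3 = "space_of T3"
  let ?a = "src (?V1 \<otimes> ?V1 \<otimes> K \<otimes> L) p" and ?b = "tgt (?V1 \<otimes> ?V1 \<otimes> K \<otimes> L) p"
  note K = intertwinerD[OF C] and L = intertwinerD[OF C']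
  note R1 = rmat_Hom[OF T1] and R2 = rmat_Hom[OF T2] and R3 = rmat_Hom[OF T3]
  note lf = locally_finite_tensor locally_finite_space_of[OF T1] locally_finite_space_of[OF T2]
    locally_finite_space_of[OF T3] K(2) L(2)
  have rf: "row_finite C" "row_finite C'" "row_finite (rmat T1 z)" "row_finite (rmat T2 z)"
    "row_finite (rmat T3 z)" for z
    by (rule row_finite_Hom[OF K(3)] row_finite_Hom[OF L(3)] row_finite_Hom[OF R1]
        row_finite_Hom[OF R2] row_finite_Hom[OF R3]; intro lf)+
  note rfs = row_finite_mcomp row_finite_on12 row_finite_on23 rf
  note pres = preserves_mcomp preserves_on12 preserves_on23 preserves_Hom[OF K(3)]
    preserves_Hom[OF L(3)] preserves_Hom[OF R1] preserves_Hom[OF R2] preserves_Hom[OF R3]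
  \<comment> \<open>The first relation with a spectator in \<open>L\<close> on the right, then the second one with a spectator
    in \<open>K\<close> on the left, each for all strings between the endpoints of \<open>p\<close> at once.\<close>
  have G1: "\<forall>\<^sub>\<approx>z. \<forall>p\<in>paths (?V1 \<otimes> ?V1 \<otimes> K \<otimes> L) ?a ?b.
      (on12 C \<odot> on23 (on12 C) \<odot> on12 (rmat T1 z)) p =
      (on23 (on12 (rmat T2 z)) \<odot> on12 C \<odot> on23 (on12 C)) p"
  proof (rule eventually_rows_on_paths)
    show "locally_finite (?V1 \<otimes> ?V1 \<otimes> K \<otimes> L)" "locally_finite (K \<otimes> ?V2 \<otimes> ?V2 \<otimes> L)"
      by (intro lf)+
    show "preserves (?V1 \<otimes> ?V1 \<otimes> K \<otimes> L) (K \<otimes> ?V2 \<otimes> ?V2 \<otimes> L)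
        (on12 C \<odot> on23 (on12 C) \<odot> on12 (rmat T1 z))" for z
      by (rule pres)+
    show "preserves (?V1 \<otimes> ?V1 \<otimes> K \<otimes> L) (K \<otimes> ?V2 \<otimes> ?V2 \<otimes> L)
        (on23 (on12 (rmat T2 z)) \<odot> on12 C \<odot> on23 (on12 C))" for z
      by (rule pres)+
  next
    fix p and q :: "'c \<times> 'a2 \<times> 'a2 \<times> 'd"
    assume p: "p \<in> idx (?V1 \<otimes> ?V1 \<otimes> K \<otimes> L)"
    obtain x y k l x' y' k' l' where pq: "p = (x, y, k, l)" "q = (x', y', k', l')"
      by (cases p; cases q)
    have "(x, y, k) \<in> idx (?V1 \<otimes> ?V1 \<otimes> K)" using p by (simp add: pq)
    with C have "\<forall>\<^sub>\<approx>z. (on12 C \<odot> on23 C \<odot> on12 (rmat T1 z)) (x, y, k) (x', y', k') =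
        (on23 (rmat T2 z) \<odot> on12 C \<odot> on23 C) (x, y, k) (x', y', k')"
      unfolding intertwiner_def by blast
    hence "\<forall>\<^sub>\<approx>z. on123 (on12 C \<odot> on23 C \<odot> on12 (rmat T1 z)) p q =
        on123 (on23 (rmat T2 z) \<odot> on12 C \<odot> on23 C) p q"
      by eventually_elim (simp add: pq)
    thus "\<forall>\<^sub>\<approx>z. (on12 C \<odot> on23 (on12 C) \<odot> on12 (rmat T1 z)) p q =
        (on23 (on12 (rmat T2 z)) \<odot> on12 C \<odot> on23 (on12 C)) p q"
      by (simp only: on123_mcomp on123_on12 on123_on23)
  qed
  have G2: "\<forall>\<^sub>\<approx>z. \<forall>p\<in>paths (K \<otimes> ?V2 \<otimes> ?V2 \<otimes> L) ?a ?b.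
      (on23 (on12 C') \<odot> on23 (on23 C') \<odot> on23 (on12 (rmat T2 z))) p =
      (on23 (on23 (rmat T3 z)) \<odot> on23 (on12 C') \<odot> on23 (on23 C')) p"
  proof (rule eventually_rows_on_paths)
    show "locally_finite (K \<otimes> ?V2 \<otimes> ?V2 \<otimes> L)" "locally_finite (K \<otimes> L \<otimes> ?V3 \<otimes> ?V3)"
      by (intro lf)+
    show "preserves (K \<otimes> ?V2 \<otimes> ?V2 \<otimes> L) (K \<otimes> L \<otimes> ?V3 \<otimes> ?V3)
        (on23 (on12 C') \<odot> on23 (on23 C') \<odot> on23 (on12 (rmat T2 z)))" for z
      by (rule pres)+
    show "preserves (K \<otimes> ?V2 \<otimes> ?V2 \<otimes> L) (K \<otimes> L \<otimes> ?V3 \<otimes> ?V3)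
        (on23 (on23 (rmat T3 z)) \<odot> on23 (on12 C') \<odot> on23 (on23 C'))" for z
      by (rule pres)+
  next
    fix p and q :: "'c \<times> 'd \<times> 'a3 \<times> 'a3"
    assume p: "p \<in> idx (K \<otimes> ?V2 \<otimes> ?V2 \<otimes> L)"
    obtain k p' k' q' where pq: "p = (k, p')" "q = (k', q')"
      by (cases p; cases q)
    have "p' \<in> idx (?V2 \<otimes> ?V2 \<otimes> L)" using p by (simp add: pq)
    with C' have "\<forall>\<^sub>\<approx>z. (on12 C' \<odot> on23 C' \<odot> on12 (rmat T2 z)) p' q' =
        (on23 (rmat T3 z) \<odot> on12 C' \<odot> on23 C') p' q'"
      unfolding intertwiner_def by blast
    hence "\<forall>\<^sub>\<approx>z. on23 (on12 C' \<odot> on23 C' \<odot> on12 (rmat T2 z)) p q =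
        on23 (on23 (rmat T3 z) \<odot> on12 C' \<odot> on23 C') p q"
      by eventually_elim (simp add: pq)
    thus "\<forall>\<^sub>\<approx>z. (on23 (on12 C') \<odot> on23 (on23 C') \<odot> on23 (on12 (rmat T2 z))) p q =
        (on23 (on23 (rmat T3 z)) \<odot> on23 (on12 C') \<odot> on23 (on23 C')) p q"
      by (simp only: on23_mcomp)
  qed
  have p': "p \<in> paths (?V1 \<otimes> ?V1 \<otimes> K \<otimes> L) ?a ?b"
    using p by (simp add: paths_def)
  show ?thesis
    using G1 G2
  proof eventually_elim
    case (elim z)
    have "(on123 (on23 C' \<odot> on12 C) \<odot> on23 (on23 C' \<odot> on12 C) \<odot> on12 (rmat T1 z)) p =
        (on23 (on12 C') \<odot> on12 C \<odot> on23 (on23 C') \<odot> on23 (on12 C) \<odot> on12 (rmat T1 z)) p"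
      by (simp add: on123_mcomp on123_on12 on123_on23 on23_mcomp mcomp_assoc rfs)
    also have "\<dots> = (on23 (on12 C') \<odot> on23 (on23 C') \<odot> on12 C \<odot> on23 (on12 C) \<odot> on12 (rmat T1 z)) p"
      by (subst on12_on34_commute_left) (intro rfs refl)+
    also have "\<dots> = (on23 (on12 C') \<odot> on23 (on23 C') \<odot>
        on23 (on12 (rmat T2 z)) \<odot> on12 C \<odot> on23 (on12 C)) p"
      by (intro mcomp_cong_row bspec[OF elim(1) p'])
    also have "\<dots> = ((on23 (on12 C') \<odot> on23 (on23 C') \<odot> on23 (on12 (rmat T2 z))) \<odot>
        on12 C \<odot> on23 (on12 C)) p"
      by (simp add: mcomp_assoc rfs)
    also have "\<dots> = ((on23 (on23 (rmat T3 z)) \<odot> on23 (on12 C') \<odot> on23 (on23 C')) \<odot>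
        on12 C \<odot> on23 (on12 C)) p"
    proof (rule mcomp_cong_rows)
      fix j assume nz: "(on12 C \<odot> on23 (on12 C)) p j \<noteq> 0"
      have "preserves (?V1 \<otimes> ?V1 \<otimes> K \<otimes> L) (K \<otimes> ?V2 \<otimes> ?V2 \<otimes> L) (on12 C \<odot> on23 (on12 C))"
        by (rule pres)+
      with nz p have "j \<in> paths (K \<otimes> ?V2 \<otimes> ?V2 \<otimes> L) ?a ?b"
        unfolding preserves_def paths_def by blast
      thus "(on23 (on12 C') \<odot> on23 (on23 C') \<odot> on23 (on12 (rmat T2 z))) j =
          (on23 (on23 (rmat T3 z)) \<odot> on23 (on12 C') \<odot> on23 (on23 C')) j"
        using elim(2) by blast
    qed
    also have "\<dots> = (on23 (on23 (rmat T3 z)) \<odot> on23 (on12 C') \<odot>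
        on23 (on23 C') \<odot> on12 C \<odot> on23 (on12 C)) p"
      by (simp add: mcomp_assoc rfs)
    also have "\<dots> = (on23 (on23 (rmat T3 z)) \<odot> on23 (on12 C') \<odot>
        on12 C \<odot> on23 (on23 C') \<odot> on23 (on12 C)) p"
      by (subst on12_on34_commute_left) (intro rfs refl)+
    also have "\<dots> = (on23 (on23 (rmat T3 z)) \<odot>
        on123 (on23 C' \<odot> on12 C) \<odot> on23 (on23 C' \<odot> on12 C)) p"
      by (simp add: on123_mcomp on123_on12 on123_on23 on23_mcomp mcomp_assoc rfs)
    finally show ?case .
  qed
qed

text \<open>
  The composite intertwiner lives on the connecting set of composable pairs and is
  \<open>C'\<^sup>(\<^sup>2\<^sup>3\<^sup>) C\<^sup>(\<^sup>1\<^sup>2\<^sup>)\<close>. Its relation is \<open>consecutive_intertwines\<close>, up to the brackets \<open>((\<beta>, \<beta>'), \<gamma>)\<close> that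
  make a pair a single element of the connecting set.
\<close>
lemma yb_equivalent_compose:
  fixes T1 :: "('o1, 'a1) triple" and T2 :: "('o2, 'a2) triple" and T3 :: "('o3, 'a3) triple"
    and K :: "('o1, 'o2, 'c) lines" and L :: "('o2, 'o3, 'd) lines"
  assumes T1: "T1 \<in> symmetric_yb_triples" and T2: "T2 \<in> symmetric_yb_triples"
    and T3: "T3 \<in> symmetric_yb_triples"
    and C: "invertible_intertwiner T1 T2 K C" and C': "invertible_intertwiner T2 T3 L C'"
  shows "yb_equivalent T1 T3"
proof -
  let ?V1 = "space_of T1" and ?V2 = "space_of T2" and ?V3 = "space_of T3"
  obtain D where I: "intertwiner T1 T2 K C" and D: "D \<in> Hom (K \<otimes> ?V2) (?V1 \<otimes> K)"
    and DC: "D \<odot> C = mid (?V1 \<otimes> K)" and CD: "C \<odot> D = mid (K \<otimes> ?V2)"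
    using C by (elim invertible_intertwinerE)
  obtain D' where I': "intertwiner T2 T3 L C'" and D': "D' \<in> Hom (L \<otimes> ?V3) (?V2 \<otimes> L)"
    and D'C': "D' \<odot> C' = mid (?V2 \<otimes> L)" and C'D': "C' \<odot> D' = mid (L \<otimes> ?V3)"
    using C' by (elim invertible_intertwinerE)
  note K = intertwinerD[OF I] and L = intertwinerD[OF I']
  note lf = locally_finite_tensor locally_finite_space_of[OF T1] locally_finite_space_of[OF T2]
    locally_finite_space_of[OF T3] K(2) L(2)
  have rf: "row_finite C" "row_finite D" "row_finite C'" "row_finite D'"
    by (rule row_finite_Hom[OF K(3)] row_finite_Hom[OF D] row_finite_Hom[OF L(3)]
        row_finite_Hom[OF D']; intro lf)+
  define E where "E = on23 C' \<odot> on12 C"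
  define F where "F = on12 D \<odot> on23 D'"
  have E: "E \<in> Hom (?V1 \<otimes> K \<otimes> L) (K \<otimes> L \<otimes> ?V3)" and F: "F \<in> Hom (K \<otimes> L \<otimes> ?V3) (?V1 \<otimes> K \<otimes> L)"
    unfolding E_def F_def by (rule on23_on12_Hom[OF K(3) L(3)] on12_on23_Hom[OF D D'])+
  have FE: "F \<odot> E = mid (?V1 \<otimes> K \<otimes> L)" and EF: "E \<odot> F = mid (K \<otimes> L \<otimes> ?V3)"
    unfolding E_def F_def
    by (rule consecutive_inverse[OF K(3) D L(3) D' rf] DC D'C' CD C'D')+
  \<comment> \<open>\<open>asc\<close>, and below \<open>asc2\<close> and \<open>asc3\<close>, bracket the two middle or first entries of a string into
    one element of the connecting set; strings in \<open>V\<^sup>\<pi>\<^sup>1 \<otimes> (K \<otimes> L)\<close> are bracketed that way already.\<close>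
  define asc :: "'c \<times> 'd \<times> 'a3 \<Rightarrow> ('c \<times> 'd) \<times> 'a3" where "asc = (\<lambda>(x, y, z). ((x, y), z))"
  define E' where "E' = (\<lambda>p ((b, b'), g). E p (b, b', g))"
  define F' where "F' = (\<lambda>((b, b'), g) q. F (b, b', g) q)"
  have E'_Hom: "E' \<in> Hom (?V1 \<otimes> (K \<otimes> L)) ((K \<otimes> L) \<otimes> ?V3)"
    unfolding Hom_def
  proof (intro CollectI allI impI)
    fix p q assume nz: "E' p q \<noteq> 0"
    obtain b b' g where q: "q = ((b, b'), g)" by (cases q) auto
    have "E p (b, b', g) \<noteq> 0" using nz by (simp add: E'_def q)
    from HomD[OF E this] show "p \<in> idx (?V1 \<otimes> (K \<otimes> L)) \<and> q \<in> idx ((K \<otimes> L) \<otimes> ?V3) \<and>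
        src (?V1 \<otimes> (K \<otimes> L)) p = src ((K \<otimes> L) \<otimes> ?V3) q \<and>
        tgt (?V1 \<otimes> (K \<otimes> L)) p = tgt ((K \<otimes> L) \<otimes> ?V3) q" by (simp add: q)
  qed
  have F'_Hom: "F' \<in> Hom ((K \<otimes> L) \<otimes> ?V3) (?V1 \<otimes> (K \<otimes> L))"
    unfolding Hom_def
  proof (intro CollectI allI impI)
    fix q p assume nz: "F' q p \<noteq> 0"
    obtain b b' g where q: "q = ((b, b'), g)" by (cases q) auto
    have "F (b, b', g) p \<noteq> 0" using nz by (simp add: F'_def q)
    from HomD[OF F this] show "q \<in> idx ((K \<otimes> L) \<otimes> ?V3) \<and> p \<in> idx (?V1 \<otimes> (K \<otimes> L)) \<and>
        src ((K \<otimes> L) \<otimes> ?V3) q = src (?V1 \<otimes> (K \<otimes> L)) p \<and>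
        tgt ((K \<otimes> L) \<otimes> ?V3) q = tgt (?V1 \<otimes> (K \<otimes> L)) p" by (simp add: q)
  qed
  have inj_asc: "inj_on asc UNIV" by (auto simp: asc_def inj_on_def)
  have surj_asc: "q \<in> range asc" for q
    by (cases q) (auto simp: asc_def image_iff)
  have relE: "relabelled id UNIV asc UNIV E E'" and relF: "relabelled asc UNIV id UNIV F F'"
    by (auto simp: relabelled_def E'_def F'_def asc_def surj_asc[unfolded asc_def])
  have "F' \<odot> E' = mid (?V1 \<otimes> K \<otimes> L)"
    by (rule relabelled_mid[OF relabelled_mcomp[OF relE relF inj_asc] _ _ _ _ FE]) auto
  moreover have "E' \<odot> F' = mid ((K \<otimes> L) \<otimes> ?V3)"
  proof (rule relabelled_mid[OF relabelled_mcomp[OF relF relE] inj_asc _ _ _ EF])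
    show "idx ((K \<otimes> L) \<otimes> ?V3) = asc ` idx (K \<otimes> L \<otimes> ?V3)"
    proof (intro equalityI subsetI)
      fix q assume q: "q \<in> idx ((K \<otimes> L) \<otimes> ?V3)"
      obtain x y g where xyg: "q = ((x, y), g)" by (cases q) auto
      have "(x, y, g) \<in> idx (K \<otimes> L \<otimes> ?V3)" "q = asc (x, y, g)"
        using q by (simp_all add: asc_def xyg)
      thus "q \<in> asc ` idx (K \<otimes> L \<otimes> ?V3)" by blast
    next
      fix q assume "q \<in> asc ` idx (K \<otimes> L \<otimes> ?V3)"
      then obtain p where p: "p \<in> idx (K \<otimes> L \<otimes> ?V3)" "q = asc p" by blast
      thus "q \<in> idx ((K \<otimes> L) \<otimes> ?V3)" by (cases p) (simp add: asc_def)
    qed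
  qed (use surj_asc in auto)
  moreover have "intertwiner T1 T3 (K \<otimes> L) E'"
    unfolding intertwiner_def
  proof (intro conjI ballI allI)
    show "connecting_set (gpd T1) (gpd T3) (K \<otimes> L)"
      unfolding connecting_set_def
    proof (intro conjI ballI)
      have lfKL: "locally_finite (K \<otimes> L)" by (intro lf)
      show "finite {\<beta> \<in> idx (K \<otimes> L). src (K \<otimes> L) \<beta> = a}" for a
        using lfKL by (simp add: locally_finite_def)
      show "finite {\<beta> \<in> idx (K \<otimes> L). tgt (K \<otimes> L) \<beta> = b}" for b
        using lfKL by (simp add: locally_finite_def)
      have Kim: "src K ` idx K = Ob (gpd T1)" "tgt K ` idx K = Ob (gpd T2)"
        and Lim: "src L ` idx L = Ob (gpd T2)" "tgt L ` idx L = Ob (gpd T3)"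
        using K(1) L(1) by (simp_all add: connecting_set_def)
      show "src (K \<otimes> L) ` idx (K \<otimes> L) = Ob (gpd T1)"
      proof (intro equalityI subsetI)
        fix a assume "a \<in> Ob (gpd T1)"
        then obtain \<beta> where \<beta>: "\<beta> \<in> idx K" "a = src K \<beta>" unfolding Kim(1)[symmetric] by blast
        hence "tgt K \<beta> \<in> src L ` idx L" unfolding Lim(1) Kim(2)[symmetric] by blast
        then obtain \<beta>' where "\<beta>' \<in> idx L" "tgt K \<beta> = src L \<beta>'" by blast
        with \<beta> have "(\<beta>, \<beta>') \<in> idx (K \<otimes> L)" "a = src (K \<otimes> L) (\<beta>, \<beta>')" by simp_all
        thus "a \<in> src (K \<otimes> L) ` idx (K \<otimes> L)" by blast
      next
        fix a assume "a \<in> src (K \<otimes> L) ` idx (K \<otimes> L)"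
        then obtain \<beta> \<beta>' where "\<beta> \<in> idx K" "a = src K \<beta>" by auto
        thus "a \<in> Ob (gpd T1)" unfolding Kim(1)[symmetric] by blast
      qed
      show "tgt (K \<otimes> L) ` idx (K \<otimes> L) = Ob (gpd T3)"
      proof (intro equalityI subsetI)
        fix b assume "b \<in> Ob (gpd T3)"
        then obtain \<beta>' where \<beta>': "\<beta>' \<in> idx L" "b = tgt L \<beta>'" unfolding Lim(2)[symmetric] by blast
        hence "src L \<beta>' \<in> tgt K ` idx K" unfolding Kim(2) Lim(1)[symmetric] by blast
        then obtain \<beta> where "\<beta> \<in> idx K" "src L \<beta>' = tgt K \<beta>" by blast
        with \<beta>' have "(\<beta>, \<beta>') \<in> idx (K \<otimes> L)" "b = tgt (K \<otimes> L) (\<beta>, \<beta>')" by simp_all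
        thus "b \<in> tgt (K \<otimes> L) ` idx (K \<otimes> L)" by blast
      next
        fix b assume "b \<in> tgt (K \<otimes> L) ` idx (K \<otimes> L)"
        then obtain \<beta> \<beta>' where "\<beta>' \<in> idx L" "b = tgt L \<beta>'" by auto
        thus "b \<in> Ob (gpd T3)" unfolding Lim(2)[symmetric] by blast
      qed
    qed
    show "E' \<in> Hom (?V1 \<otimes> K \<otimes> L) ((K \<otimes> L) \<otimes> ?V3)" by (rule E'_Hom)
  next
    fix p q assume p: "p \<in> idx (?V1 \<otimes> ?V1 \<otimes> K \<otimes> L)"
    define asc2 :: "'a1 \<times> 'c \<times> 'd \<times> 'a3 \<Rightarrow> 'a1 \<times> ('c \<times> 'd) \<times> 'a3"
      where "asc2 = (\<lambda>(w, x, y, z). (w, (x, y), z))"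
    define asc3 :: "'c \<times> 'd \<times> 'a3 \<times> 'a3 \<Rightarrow> ('c \<times> 'd) \<times> 'a3 \<times> 'a3"
      where "asc3 = (\<lambda>(x, y, z, z'). ((x, y), z, z'))"
    have inj2: "inj_on asc2 UNIV" and inj3: "inj_on asc3 UNIV"
      by (auto simp: asc2_def asc3_def inj_on_def)
    have surj2: "u \<in> range asc2" for u by (cases u) (auto simp: asc2_def image_iff)
    have surj3: "u \<in> range asc3" for u by (cases u) (auto simp: asc3_def image_iff)
    have rels: "relabelled id UNIV id UNIV (on12 (rmat T1 z)) (on12 (rmat T1 z))"
        "relabelled id UNIV asc2 UNIV (on23 E) (on23 E')"
        "relabelled asc2 UNIV asc3 UNIV (on123 E) (on12 E')"
        "relabelled asc3 UNIV asc3 UNIV (on23 (on23 (rmat T3 z))) (on23 (rmat T3 z))" for z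
      using surj2 surj3 by (auto simp: relabelled_def asc2_def asc3_def E'_def)
    obtain q' where q: "q = asc3 q'" using surj3[of q] by blast
    have l: "(on12 E' \<odot> on23 E' \<odot> on12 (rmat T1 z)) p q = (on123 E \<odot> on23 E \<odot> on12 (rmat T1 z)) p q'" for z
      using relabelledD[OF relabelled_mcomp[OF relabelled_mcomp[OF rels(1)[of z] rels(2)] rels(3) inj2],
        of p q'] by (simp add: q)
    have r: "(on23 (rmat T3 z) \<odot> on12 E' \<odot> on23 E') p q =
        (on23 (on23 (rmat T3 z)) \<odot> on123 E \<odot> on23 E) p q'" for z
      using relabelledD[OF relabelled_mcomp[OF relabelled_mcomp[OF rels(2,3) inj2] rels(4)[of z] inj3],
        of p q'] by (simp add: q)
    show "\<forall>\<^sub>\<approx>z. (on12 E' \<odot> on23 E' \<odot> on12 (rmat T1 z)) p q = (on23 (rmat T3 z) \<odot> on12 E' \<odot> on23 E') p q"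
      unfolding l r using consecutive_intertwines[OF T1 T2 T3 I I' p, folded E_def]
      by eventually_elim simp
  qed
  ultimately have "invertible_intertwiner T1 T3 (K \<otimes> L) E'"
    unfolding invertible_intertwiner_def using F'_Hom by blast
  thus ?thesis by (rule yb_equivalentI)
qed


section \<open>Symmetry\<close>

text \<open>
  The plain matrix transpose, as opposed to \<^term>\<open>mtranspose T\<close>, which also reverses strings.
\<close>
definition flip :: "('x, 'y) mat \<Rightarrow> ('y, 'x) mat" where
  "flip M = (\<lambda>q p. M p q)"

lemma flip_mcomp: "flip (N \<odot> M) = flip M \<odot> flip N"
  by (simp add: flip_def mcomp_def fun_eq_iff mult.commute)

lemma mtranspose_Hom:
  assumes T: "T \<in> symmetric_yb_triples"
    and M: "M \<in> Hom (space_of T \<otimes> space_of T) (space_of T \<otimes> space_of T)"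
  shows "mtranspose T M \<in> Hom (space_of T \<otimes> space_of T) (space_of T \<otimes> space_of T)"
  unfolding Hom_def
proof (intro CollectI allI impI)
  fix p q assume nz: "mtranspose T M p q \<noteq> 0"
  obtain \<alpha> \<beta> \<gamma> \<delta> where pq: "p = (\<alpha>, \<beta>)" "q = (\<gamma>, \<delta>)" by (cases p; cases q)
  let ?i = "Inv (gpd T)" and ?V = "space_of T"
  have idx: "p \<in> idx (?V \<otimes> ?V)" "q \<in> idx (?V \<otimes> ?V)" and "M (?i \<delta>, ?i \<gamma>) (?i \<beta>, ?i \<alpha>) \<noteq> 0"
    using nz by (auto simp: mtranspose_def pq split: if_splits)
  from HomD(3,4)[OF M this(3)] idx
  show "p \<in> idx (?V \<otimes> ?V) \<and> q \<in> idx (?V \<otimes> ?V) \<and>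
      src (?V \<otimes> ?V) p = src (?V \<otimes> ?V) q \<and> tgt (?V \<otimes> ?V) p = tgt (?V \<otimes> ?V) q"
    by (simp add: pq supp_Inv[OF T])
qed

text \<open>
  Reversing strings and inverting their arrows carries the plain transpose of an operator to its
  transpose in the sense of the symmetry condition. Outside the composable strings both sides
  vanish.
\<close>
lemma mtranspose_inverses:
  assumes T: "T \<in> symmetric_yb_triples"
    and M: "M \<in> Hom (space_of T \<otimes> space_of T) (space_of T \<otimes> space_of T)"
    and S: "\<alpha> \<in> supp T" "\<beta> \<in> supp T" "\<gamma> \<in> supp T" "\<delta> \<in> supp T"
  shows "mtranspose T M (Inv (gpd T) \<delta>, Inv (gpd T) \<gamma>) (Inv (gpd T) \<beta>, Inv (gpd T) \<alpha>) = M (\<alpha>, \<beta>) (\<gamma>, \<delta>)"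
proof (cases "M (\<alpha>, \<beta>) (\<gamma>, \<delta>) = 0")
  case True
  thus ?thesis using S by (simp add: mtranspose_def supp_Inv[OF T])
next
  case False
  from HomD(1,2)[OF M this] show ?thesis
    using S by (simp add: mtranspose_def supp_Inv[OF T])
qed

text \<open>
  The inverse of \<open>C\<close> does intertwine \<open>R\<^sub>2\<close> and \<open>R\<^sub>1\<close>, but with \<open>V\<^sup>\<pi>\<close> on the wrong side. To move it
  across, the connecting set is reversed, and strings are read backwards with their arrows
  inverted. This reversal interchanges \<open>M\<^sup>(\<^sup>1\<^sup>2\<^sup>)\<close> and \<open>M\<^sup>(\<^sup>2\<^sup>3\<^sup>)\<close> but keeps the order of composition, so it
  is combined with the plain transposition of matrices, which reverses this order. Together they
  turn the relation for \<open>C\<close> into the one for \<open>C'\<close> with \<open>R\<^sub>1\<close> and \<open>R\<^sub>2\<close> replaced by their transposes,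
  and these equal \<open>R\<^sub>1\<close> and \<open>R\<^sub>2\<close> by symmetry. In this way \<open>C\<close> itself, not its inverse, gives the
  dual intertwiner \<open>C'\<close>, and the inverse of \<open>C\<close> gives the inverse of \<open>C'\<close>.
\<close>
lemma yb_equivalent_dual:
  fixes T1 :: "('o1, 'a1) triple" and T2 :: "('o2, 'a2) triple" and K :: "('o1, 'o2, 'c) lines"
  assumes T1: "T1 \<in> symmetric_yb_triples" and T2: "T2 \<in> symmetric_yb_triples"
    and C: "invertible_intertwiner T1 T2 K C"
  shows "yb_equivalent T2 T1"
proof -
  let ?V1 = "space_of T1" and ?V2 = "space_of T2"
  let ?S1 = "supp T1" and ?S2 = "supp T2"
  let ?i1 = "Inv (gpd T1)" and ?i2 = "Inv (gpd T2)"
  obtain D where I: "intertwiner T1 T2 K C" and D: "D \<in> Hom (K \<otimes> ?V2) (?V1 \<otimes> K)"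
    and DC: "D \<odot> C = mid (?V1 \<otimes> K)" and CD: "C \<odot> D = mid (K \<otimes> ?V2)"
    using C by (elim invertible_intertwinerE)
  note K = intertwinerD[OF I]
  note R1 = rmat_Hom[OF T1] and R2 = rmat_Hom[OF T2]
  note i1 = supp_Inv[OF T1] and i2 = supp_Inv[OF T2]
  have i_eq: "?i1 \<alpha> = ?i1 \<alpha>' \<longleftrightarrow> \<alpha> = \<alpha>'" if "\<alpha> \<in> ?S1" "\<alpha>' \<in> ?S1" for \<alpha> \<alpha>'
    using i1(2) that by metis
  have i_eq': "?i2 \<alpha> = ?i2 \<alpha>' \<longleftrightarrow> \<alpha> = \<alpha>'" if "\<alpha> \<in> ?S2" "\<alpha>' \<in> ?S2" for \<alpha> \<alpha>'
    using i2(2) that by metis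
  define K' :: "('o2, 'o1, 'c) lines" where "K' = \<lparr> idx = idx K, src = tgt K, tgt = src K \<rparr>"
  have K'_simps [simp]: "idx K' = idx K" "src K' = tgt K" "tgt K' = src K"
    by (simp_all add: K'_def)
  define C' :: "('a2 \<times> 'c, 'c \<times> 'a1) mat" where "C' = (\<lambda>(\<gamma>, k) (k', \<alpha>).
    if \<alpha> \<in> ?S1 \<and> \<gamma> \<in> ?S2 then C (?i1 \<alpha>, k') (k, ?i2 \<gamma>) else 0)"
  define D' :: "('c \<times> 'a1, 'a2 \<times> 'c) mat" where "D' = (\<lambda>(k', \<alpha>) (\<gamma>, k).
    if \<alpha> \<in> ?S1 \<and> \<gamma> \<in> ?S2 then D (k, ?i2 \<gamma>) (?i1 \<alpha>, k') else 0)"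
  have C'_app: "C' (\<gamma>, k) (k', \<alpha>) = (if \<alpha> \<in> ?S1 \<and> \<gamma> \<in> ?S2 then C (?i1 \<alpha>, k') (k, ?i2 \<gamma>) else 0)"
    for \<gamma> k k' \<alpha> by (simp add: C'_def)
  have D'_app: "D' (k', \<alpha>) (\<gamma>, k) = (if \<alpha> \<in> ?S1 \<and> \<gamma> \<in> ?S2 then D (k, ?i2 \<gamma>) (?i1 \<alpha>, k') else 0)"
    for \<gamma> k k' \<alpha> by (simp add: D'_def)
  have C_supp: "\<alpha> \<in> ?S1 \<and> \<gamma> \<in> ?S2" if "C (\<alpha>, k) (k', \<gamma>) \<noteq> 0" for \<alpha> k k' \<gamma>
    using HomD(1,2)[OF K(3) that] by simp
  have D_supp: "\<alpha> \<in> ?S1 \<and> \<gamma> \<in> ?S2" if "D (k', \<gamma>) (\<alpha>, k) \<noteq> 0" for \<alpha> k k' \<gamma>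
    using HomD(1,2)[OF D that] by simp
  have R1_supp: "\<alpha> \<in> ?S1 \<and> \<beta> \<in> ?S1 \<and> \<gamma> \<in> ?S1 \<and> \<delta> \<in> ?S1" if "M \<in> Hom (?V1 \<otimes> ?V1) (?V1 \<otimes> ?V1)" "M (\<alpha>, \<beta>) (\<gamma>, \<delta>) \<noteq> 0"
    for M \<alpha> \<beta> \<gamma> \<delta> using HomD(1,2)[OF that] by simp
  have R2_supp: "\<alpha> \<in> ?S2 \<and> \<beta> \<in> ?S2 \<and> \<gamma> \<in> ?S2 \<and> \<delta> \<in> ?S2" if "M \<in> Hom (?V2 \<otimes> ?V2) (?V2 \<otimes> ?V2)" "M (\<alpha>, \<beta>) (\<gamma>, \<delta>) \<noteq> 0"
    for M \<alpha> \<beta> \<gamma> \<delta> using HomD(1,2)[OF that] by simp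

  have C'_Hom: "C' \<in> Hom (?V2 \<otimes> K') (K' \<otimes> ?V1)"
    unfolding Hom_def
  proof (intro CollectI allI impI)
    fix p q assume nz: "C' p q \<noteq> 0"
    obtain \<gamma> k k' \<alpha> where pq: "p = (\<gamma>, k)" "q = (k', \<alpha>)" by (cases p; cases q)
    have S: "\<alpha> \<in> ?S1" "\<gamma> \<in> ?S2" and "C (?i1 \<alpha>, k') (k, ?i2 \<gamma>) \<noteq> 0"
      using nz by (simp_all add: pq C'_app split: if_splits)
    from HomD[OF K(3) this(3)] S
    show "p \<in> idx (?V2 \<otimes> K') \<and> q \<in> idx (K' \<otimes> ?V1) \<and>
        src (?V2 \<otimes> K') p = src (K' \<otimes> ?V1) q \<and> tgt (?V2 \<otimes> K') p = tgt (K' \<otimes> ?V1) q"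
      by (simp add: pq i1 i2)
  qed
  have D'_Hom: "D' \<in> Hom (K' \<otimes> ?V1) (?V2 \<otimes> K')"
    unfolding Hom_def
  proof (intro CollectI allI impI)
    fix p q assume nz: "D' p q \<noteq> 0"
    obtain \<gamma> k k' \<alpha> where pq: "q = (\<gamma>, k)" "p = (k', \<alpha>)" by (cases p; cases q)
    have S: "\<alpha> \<in> ?S1" "\<gamma> \<in> ?S2" and "D (k, ?i2 \<gamma>) (?i1 \<alpha>, k') \<noteq> 0"
      using nz by (simp_all add: pq D'_app split: if_splits)
    from HomD[OF D this(3)] S
    show "p \<in> idx (K' \<otimes> ?V1) \<and> q \<in> idx (?V2 \<otimes> K') \<and>
        src (K' \<otimes> ?V1) p = src (?V2 \<otimes> K') q \<and> tgt (K' \<otimes> ?V1) p = tgt (?V2 \<otimes> K') q"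
      by (simp add: pq i1 i2)
  qed

  \<comment> \<open>Reversal of strings of length two. It is invertible where the arrows lie in the supports,
    because inversion is only known to be an involution there; primes denote the inverse maps.\<close>
  define A1 where "A1 = ?S1 \<times> (UNIV :: 'c set)"
  define A2 where "A2 = (UNIV :: 'c set) \<times> ?S2"
  define \<phi>1 where "\<phi>1 = (\<lambda>(\<alpha>, k :: 'c). (k, ?i1 \<alpha>))"
  define \<phi>1' where "\<phi>1' = (\<lambda>(k :: 'c, \<alpha>). (?i1 \<alpha>, k))"
  define \<phi>2 where "\<phi>2 = (\<lambda>(k :: 'c, \<gamma>). (?i2 \<gamma>, k))"
  define \<phi>2' where "\<phi>2' = (\<lambda>(\<gamma>, k :: 'c). (k, ?i2 \<gamma>))"
  have inj1: "inj_on \<phi>1 A1"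
    by (rule inj_on_inverseI[of _ \<phi>1']) (auto simp: A1_def \<phi>1_def \<phi>1'_def i1)
  have inj2: "inj_on \<phi>2 A2"
    by (rule inj_on_inverseI[of _ \<phi>2']) (auto simp: A2_def \<phi>2_def \<phi>2'_def i2)
  have relC: "relabelled \<phi>2 A2 \<phi>1 A1 (flip C) C'"
  proof (rule relabelledI[where \<psi>' = \<phi>1'])
    show "C' (\<phi>2 p) (\<phi>1 q) = flip C p q" if "p \<in> A2" "q \<in> A1" for p q
      using that by (cases p; cases q) (simp add: A1_def A2_def \<phi>1_def \<phi>2_def C'_app flip_def i1 i2)
    show "q \<in> A1" if "flip C p q \<noteq> 0" for p q
      using that C_supp by (cases p; cases q) (simp add: A1_def flip_def)
    show "\<phi>1' q' \<in> A1 \<and> \<phi>1 (\<phi>1' q') = q'" if "C' (\<phi>2 p) q' \<noteq> 0" for p q'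
      using that by (cases p; cases q') (simp add: A1_def \<phi>1_def \<phi>2_def \<phi>1'_def C'_app i1 split: if_splits)
  qed
  have relD: "relabelled \<phi>1 A1 \<phi>2 A2 (flip D) D'"
  proof (rule relabelledI[where \<psi>' = \<phi>2'])
    show "D' (\<phi>1 p) (\<phi>2 q) = flip D p q" if "p \<in> A1" "q \<in> A2" for p q
      using that by (cases p; cases q) (simp add: A1_def A2_def \<phi>1_def \<phi>2_def D'_app flip_def i1 i2)
    show "q \<in> A2" if "flip D p q \<noteq> 0" for p q
      using that D_supp by (cases p; cases q) (simp add: A2_def flip_def)
    show "\<phi>2' q' \<in> A2 \<and> \<phi>2 (\<phi>2' q') = q'" if "D' (\<phi>1 p) q' \<noteq> 0" for p q'
      using that by (cases p; cases q') (simp add: A2_def \<phi>1_def \<phi>2_def \<phi>2'_def D'_app i2 split: if_splits)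
  qed
  have flip_mid: "flip (mid V) = mid V" for V :: "('s, 't, 'x) lines"
    by (auto simp: flip_def mid_def fun_eq_iff)
  have D'C': "D' \<odot> C' = mid (?V2 \<otimes> K')"
  proof (rule relabelled_mid[OF relabelled_mcomp[OF relC relD inj1] inj2])
    show "flip D \<odot> flip C = mid (K \<otimes> ?V2)"
      by (simp only: flip_mcomp[symmetric] CD flip_mid)
    show "idx (K \<otimes> ?V2) \<subseteq> A2" by (auto simp: A2_def)
    show "idx (?V2 \<otimes> K') = \<phi>2 ` idx (K \<otimes> ?V2)"
    proof (intro equalityI subsetI)
      fix p assume "p \<in> idx (?V2 \<otimes> K')"
      hence "\<phi>2' p \<in> idx (K \<otimes> ?V2)" "p = \<phi>2 (\<phi>2' p)"
        by (cases p; simp add: \<phi>2_def \<phi>2'_def i2)+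
      thus "p \<in> \<phi>2 ` idx (K \<otimes> ?V2)" by blast
    qed (auto simp: \<phi>2_def i2)
    fix p' q' assume p': "p' \<notin> \<phi>2 ` A2"
    show "(D' \<odot> C') p' q' = 0"
    proof (rule ccontr)
      assume "(D' \<odot> C') p' q' \<noteq> 0"
      then obtain j where nz: "C' p' j \<noteq> 0" by (elim mcomp_nonzeroE)
      have "\<phi>2' p' \<in> A2" "p' = \<phi>2 (\<phi>2' p')"
        using HomD(1)[OF C'_Hom nz] by (cases p'; simp add: \<phi>2_def \<phi>2'_def A2_def i2)+
      with p' show False by blast
    qed
  qed
  have C'D': "C' \<odot> D' = mid (K' \<otimes> ?V1)"
  proof (rule relabelled_mid[OF relabelled_mcomp[OF relD relC inj2] inj1])
    show "flip C \<odot> flip D = mid (?V1 \<otimes> K)"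
      by (simp only: flip_mcomp[symmetric] DC flip_mid)
    show "idx (?V1 \<otimes> K) \<subseteq> A1" by (auto simp: A1_def)
    show "idx (K' \<otimes> ?V1) = \<phi>1 ` idx (?V1 \<otimes> K)"
    proof (intro equalityI subsetI)
      fix p assume "p \<in> idx (K' \<otimes> ?V1)"
      hence "\<phi>1' p \<in> idx (?V1 \<otimes> K)" "p = \<phi>1 (\<phi>1' p)"
        by (cases p; simp add: \<phi>1_def \<phi>1'_def i1)+
      thus "p \<in> \<phi>1 ` idx (?V1 \<otimes> K)" by blast
    qed (auto simp: \<phi>1_def i1)
    fix p' q' assume p': "p' \<notin> \<phi>1 ` A1"
    show "(C' \<odot> D') p' q' = 0"
    proof (rule ccontr)
      assume "(C' \<odot> D') p' q' \<noteq> 0"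
      then obtain j where nz: "D' p' j \<noteq> 0" by (elim mcomp_nonzeroE)
      have "\<phi>1' p' \<in> A1" "p' = \<phi>1 (\<phi>1' p')"
        using HomD(1)[OF D'_Hom nz] by (cases p'; simp add: \<phi>1_def \<phi>1'_def A1_def i1)+
      with p' show False by blast
    qed
  qed
  have conn: "connecting_set (gpd T2) (gpd T1) K'"
    using K(1) by (simp add: connecting_set_def)

  \<comment> \<open>Reversal of strings of length three, with the element of the connecting set in first, second
    and third position.\<close>
  define P1 where "P1 = (UNIV :: 'c set) \<times> ?S2 \<times> ?S2"
  define P2 where "P2 = ?S1 \<times> (UNIV :: 'c set) \<times> ?S2"
  define P3 where "P3 = ?S1 \<times> ?S1 \<times> (UNIV :: 'c set)"
  define \<rho>1 where "\<rho>1 = (\<lambda>(k :: 'c, \<gamma>, \<gamma>'). (?i2 \<gamma>', ?i2 \<gamma>, k))"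
  define \<rho>1' where "\<rho>1' = (\<lambda>(\<gamma>', \<gamma>, k :: 'c). (k, ?i2 \<gamma>, ?i2 \<gamma>'))"
  define \<rho>2 where "\<rho>2 = (\<lambda>(\<alpha>, k :: 'c, \<gamma>). (?i2 \<gamma>, k, ?i1 \<alpha>))"
  define \<rho>2' where "\<rho>2' = (\<lambda>(\<gamma>, k :: 'c, \<alpha>). (?i1 \<alpha>, k, ?i2 \<gamma>))"
  define \<rho>3 where "\<rho>3 = (\<lambda>(\<alpha>, \<alpha>', k :: 'c). (k, ?i1 \<alpha>', ?i1 \<alpha>))"
  define \<rho>3' where "\<rho>3' = (\<lambda>(k :: 'c, \<alpha>', \<alpha>). (?i1 \<alpha>, ?i1 \<alpha>', k))"
  note defs = P1_def P2_def P3_def \<rho>1_def \<rho>1'_def \<rho>2_def \<rho>2'_def \<rho>3_def \<rho>3'_def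
  have injr: "inj_on \<rho>1 P1" "inj_on \<rho>2 P2" "inj_on \<rho>3 P3"
    by (rule inj_on_inverseI[of _ \<rho>1'], auto simp: defs i2)
       (rule inj_on_inverseI[of _ \<rho>2'], auto simp: defs i1 i2,
        rule inj_on_inverseI[of _ \<rho>3'], auto simp: defs i1)
  let ?Rt1 = "\<lambda>z. mtranspose T1 (rmat T1 z)" and ?Rt2 = "\<lambda>z. mtranspose T2 (rmat T2 z)"
  note Rt1 = mtranspose_Hom[OF T1 R1] and Rt2 = mtranspose_Hom[OF T2 R2]
  have relR2: "relabelled \<rho>1 P1 \<rho>1 P1 (flip (on23 (rmat T2 z))) (on12 (?Rt2 z))" for z
  proof (rule relabelledI[where \<psi>' = \<rho>1'])
    show "on12 (?Rt2 z) (\<rho>1 p) (\<rho>1 q) = flip (on23 (rmat T2 z)) p q" if "p \<in> P1" "q \<in> P1" for p q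
      using that by (cases p; cases q) (simp add: defs flip_def mtranspose_inverses[OF T2 R2])
    show "q \<in> P1" if "flip (on23 (rmat T2 z)) p q \<noteq> 0" for p q
      using that R2_supp[OF R2, of z] by (cases p; cases q) (simp add: defs flip_def split: if_splits)
    show "\<rho>1' q' \<in> P1 \<and> \<rho>1 (\<rho>1' q') = q'" if "p \<in> P1" "on12 (?Rt2 z) (\<rho>1 p) q' \<noteq> 0" for p q'
      using that R2_supp[OF Rt2, of z]
      by (cases p; cases q') (simp add: defs i2 split: if_splits)
  qed
  have relR1: "relabelled \<rho>3 P3 \<rho>3 P3 (flip (on12 (rmat T1 z))) (on23 (?Rt1 z))" for z
  proof (rule relabelledI[where \<psi>' = \<rho>3'])
    show "on23 (?Rt1 z) (\<rho>3 p) (\<rho>3 q) = flip (on12 (rmat T1 z)) p q" if "p \<in> P3" "q \<in> P3" for p q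
      using that by (cases p; cases q) (simp add: defs flip_def mtranspose_inverses[OF T1 R1])
    show "q \<in> P3" if "flip (on12 (rmat T1 z)) p q \<noteq> 0" for p q
      using that R1_supp[OF R1, of z] by (cases p; cases q) (simp add: defs flip_def split: if_splits)
    show "\<rho>3' q' \<in> P3 \<and> \<rho>3 (\<rho>3' q') = q'" if "p \<in> P3" "on23 (?Rt1 z) (\<rho>3 p) q' \<noteq> 0" for p q'
      using that R1_supp[OF Rt1, of z]
      by (cases p; cases q') (simp add: defs i1 split: if_splits)
  qed
  have relC12: "relabelled \<rho>1 P1 \<rho>2 P2 (flip (on12 C)) (on23 C')"
  proof (rule relabelledI[where \<psi>' = \<rho>2'])
    show "on23 C' (\<rho>1 p) (\<rho>2 q) = flip (on12 C) p q" if "p \<in> P1" "q \<in> P2" for p q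
      using that by (cases p; cases q) (auto simp: defs flip_def C'_app i1 i2 i_eq')
    show "q \<in> P2" if "p \<in> P1" "flip (on12 C) p q \<noteq> 0" for p q
      using that C_supp by (cases p; cases q) (simp add: defs flip_def split: if_splits)
    show "\<rho>2' q' \<in> P2 \<and> \<rho>2 (\<rho>2' q') = q'" if "p \<in> P1" "on23 C' (\<rho>1 p) q' \<noteq> 0" for p q'
      using that by (cases p; cases q') (auto simp: defs C'_app i1 i2 split: if_splits)
  qed
  have relC23: "relabelled \<rho>2 P2 \<rho>3 P3 (flip (on23 C)) (on12 C')"
  proof (rule relabelledI[where \<psi>' = \<rho>3'])
    show "on12 C' (\<rho>2 p) (\<rho>3 q) = flip (on23 C) p q" if "p \<in> P2" "q \<in> P3" for p q
      using that by (cases p; cases q) (auto simp: defs flip_def C'_app i1 i2 i_eq)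
    show "q \<in> P3" if "p \<in> P2" "flip (on23 C) p q \<noteq> 0" for p q
      using that C_supp by (cases p; cases q) (simp add: defs flip_def split: if_splits)
    show "\<rho>3' q' \<in> P3 \<and> \<rho>3 (\<rho>3' q') = q'" if "p \<in> P2" "on12 C' (\<rho>2 p) q' \<noteq> 0" for p q'
      using that by (cases p; cases q') (auto simp: defs C'_app i1 i2 split: if_splits)
  qed

  note lf = locally_finite_tensor locally_finite_space_of[OF T1] locally_finite_space_of[OF T2]
    K(2) locally_finite_connecting_set[OF conn]
  have rf: "row_finite C" "row_finite (rmat T1 z)" "row_finite (rmat T2 z)" for z
    by (rule row_finite_Hom[OF K(3)] row_finite_Hom[OF R1] row_finite_Hom[OF R2]; intro lf)+
  note rfs = row_finite_mcomp row_finite_on12 row_finite_on23 rf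
  have L: "relabelled \<rho>1 P1 \<rho>3 P3 (flip (on23 (rmat T2 z) \<odot> on12 C \<odot> on23 C))
      (on12 C' \<odot> on23 C' \<odot> on12 (?Rt2 z))" for z
  proof -
    have "flip (on23 (rmat T2 z) \<odot> on12 C \<odot> on23 C) = flip ((on23 (rmat T2 z) \<odot> on12 C) \<odot> on23 C)"
      by (subst mcomp_assoc) (intro rfs refl)+
    also have "\<dots> = flip (on23 C) \<odot> flip (on12 C) \<odot> flip (on23 (rmat T2 z))"
      by (simp only: flip_mcomp)
    finally show ?thesis
      using relabelled_mcomp[OF relabelled_mcomp[OF relR2 relC12 injr(1)] relC23 injr(2)] by simp
  qed
  have R: "relabelled \<rho>1 P1 \<rho>3 P3 (flip (on12 C \<odot> on23 C \<odot> on12 (rmat T1 z)))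
      (on23 (?Rt1 z) \<odot> on12 C' \<odot> on23 C')" for z
  proof -
    have "flip (on12 C \<odot> on23 C \<odot> on12 (rmat T1 z)) = flip ((on12 C \<odot> on23 C) \<odot> on12 (rmat T1 z))"
      by (subst mcomp_assoc) (intro rfs refl)+
    also have "\<dots> = flip (on12 (rmat T1 z)) \<odot> flip (on23 C) \<odot> flip (on12 C)"
      by (simp only: flip_mcomp)
    finally show ?thesis
      using relabelled_mcomp[OF relabelled_mcomp[OF relC12 relC23 injr(2)] relR1 injr(3)] by simp
  qed
  note pres = preserves_mcomp preserves_on12 preserves_on23 preserves_Hom[OF C'_Hom]
    preserves_Hom[OF R1] preserves_Hom[OF R2] preserves_Hom[OF Rt1] preserves_Hom[OF Rt2]
  \<comment> \<open>This is where the symmetry of the two operators enters.\<close>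
  have sym1: "\<forall>\<^sub>\<approx>z. \<forall>p\<in>paths (K' \<otimes> ?V1 \<otimes> ?V1) a b. on23 (?Rt1 z) p = on23 (rmat T1 z) p" for a b
  proof (rule eventually_rows_on_paths)
    show "locally_finite (K' \<otimes> ?V1 \<otimes> ?V1)" "locally_finite (K' \<otimes> ?V1 \<otimes> ?V1)"
      by (intro lf)+
    show "preserves (K' \<otimes> ?V1 \<otimes> ?V1) (K' \<otimes> ?V1 \<otimes> ?V1) (on23 (?Rt1 z))"
      "preserves (K' \<otimes> ?V1 \<otimes> ?V1) (K' \<otimes> ?V1 \<otimes> ?V1) (on23 (rmat T1 z))" for z
      by (rule pres)+
    fix p q :: "'c \<times> 'a1 \<times> 'a1"
    have "\<forall>\<^sub>\<approx>z. ?Rt1 z (snd p) (snd q) = rmat T1 z (snd p) (snd q)"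
      using T1 by (simp only: symmetric_yb_triples_def symmetric_operator_def mem_Collect_eq)
    thus "\<forall>\<^sub>\<approx>z. on23 (?Rt1 z) p q = on23 (rmat T1 z) p q"
      by eventually_elim (cases p; cases q; simp)
  qed
  have sym2: "\<forall>\<^sub>\<approx>z. \<forall>p\<in>paths (?V2 \<otimes> ?V2 \<otimes> K') a b. on12 (?Rt2 z) p = on12 (rmat T2 z) p" for a b
  proof (rule eventually_rows_on_paths)
    show "locally_finite (?V2 \<otimes> ?V2 \<otimes> K')" "locally_finite (?V2 \<otimes> ?V2 \<otimes> K')"
      by (intro lf)+
    show "preserves (?V2 \<otimes> ?V2 \<otimes> K') (?V2 \<otimes> ?V2 \<otimes> K') (on12 (?Rt2 z))"
      "preserves (?V2 \<otimes> ?V2 \<otimes> K') (?V2 \<otimes> ?V2 \<otimes> K') (on12 (rmat T2 z))" for z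
      by (rule pres)+
    fix p q :: "'a2 \<times> 'a2 \<times> 'c"
    obtain x y k x' y' k' where pq: "p = (x, y, k)" "q = (x', y', k')" by (cases p; cases q)
    have "\<forall>\<^sub>\<approx>z. ?Rt2 z (x, y) (x', y') = rmat T2 z (x, y) (x', y')"
      using T2 by (simp only: symmetric_yb_triples_def symmetric_operator_def mem_Collect_eq)
    thus "\<forall>\<^sub>\<approx>z. on12 (?Rt2 z) p q = on12 (rmat T2 z) p q"
      by eventually_elim (simp add: pq)
  qed
  have "intertwiner T2 T1 K' C'"
    unfolding intertwiner_def
  proof (intro conjI ballI allI)
    fix p and q :: "'c \<times> 'a1 \<times> 'a1" assume p: "p \<in> idx (?V2 \<otimes> ?V2 \<otimes> K')"
    define a where "a = src (?V2 \<otimes> ?V2 \<otimes> K') p"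
    define b where "b = tgt (?V2 \<otimes> ?V2 \<otimes> K') p"
    have pp: "p \<in> paths (?V2 \<otimes> ?V2 \<otimes> K') a b"
      using p by (simp add: paths_def a_def b_def)
    have p0: "\<rho>1' p \<in> P1" "p = \<rho>1 (\<rho>1' p)"
      using p by (cases p; simp add: defs i2)+
    show "\<forall>\<^sub>\<approx>z. (on12 C' \<odot> on23 C' \<odot> on12 (rmat T2 z)) p q = (on23 (rmat T1 z) \<odot> on12 C' \<odot> on23 C') p q"
      using sym1[of a b] sym2[of a b] eventually_intertwines[OF T1 T2 I, of b a]
    proof eventually_elim
      case (elim z)
      have "(on12 C' \<odot> on23 C' \<odot> on12 (rmat T2 z)) p = (on12 C' \<odot> on23 C' \<odot> on12 (?Rt2 z)) p"
        by (intro mcomp_cong_row bspec[OF elim(2) pp, symmetric])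
      moreover have "(on23 (rmat T1 z) \<odot> on12 C' \<odot> on23 C') p = (on23 (?Rt1 z) \<odot> on12 C' \<odot> on23 C') p"
      proof (rule mcomp_cong_rows)
        fix j assume nz: "(on12 C' \<odot> on23 C') p j \<noteq> 0"
        have "preserves (?V2 \<otimes> ?V2 \<otimes> K') (K' \<otimes> ?V1 \<otimes> ?V1) (on12 C' \<odot> on23 C')"
          by (rule pres)+
        with nz p have "j \<in> paths (K' \<otimes> ?V1 \<otimes> ?V1) a b"
          unfolding preserves_def paths_def a_def b_def by blast
        thus "on23 (rmat T1 z) j = on23 (?Rt1 z) j"
          using elim(1) by simp
      qed
      moreover have "(on12 C' \<odot> on23 C' \<odot> on12 (?Rt2 z)) p q = (on23 (?Rt1 z) \<odot> on12 C' \<odot> on23 C') p q"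
      proof (cases "q \<in> paths (K' \<otimes> ?V1 \<otimes> ?V1) a b")
        case True
        have q0: "\<rho>3' q \<in> P3" "q = \<rho>3 (\<rho>3' q)" "\<rho>3' q \<in> paths (?V1 \<otimes> ?V1 \<otimes> K) b a"
          using True by (cases q; simp add: defs i1 paths_def)+
        have "(on12 C' \<odot> on23 C' \<odot> on12 (?Rt2 z)) p q =
            flip (on23 (rmat T2 z) \<odot> on12 C \<odot> on23 C) (\<rho>1' p) (\<rho>3' q)"
          using relabelledD[OF L p0(1) q0(1), of z] p0(2) q0(2) by simp
        also have "\<dots> = flip (on12 C \<odot> on23 C \<odot> on12 (rmat T1 z)) (\<rho>1' p) (\<rho>3' q)"
          using bspec[OF elim(3) q0(3)] by (simp add: flip_def)
        also have "\<dots> = (on23 (?Rt1 z) \<odot> on12 C' \<odot> on23 C') p q"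
          using relabelledD[OF R p0(1) q0(1), of z] p0(2) q0(2) by simp
        finally show ?thesis .
      next
        case False
        have "preserves (?V2 \<otimes> ?V2 \<otimes> K') (K' \<otimes> ?V1 \<otimes> ?V1) (on12 C' \<odot> on23 C' \<odot> on12 (?Rt2 z))"
          by (rule pres)+
        moreover have "preserves (?V2 \<otimes> ?V2 \<otimes> K') (K' \<otimes> ?V1 \<otimes> ?V1) (on23 (?Rt1 z) \<odot> on12 C' \<odot> on23 C')"
          by (rule pres)+
        ultimately show ?thesis
          using False p unfolding preserves_def paths_def a_def b_def mem_Collect_eq by metis
      qed
      ultimately show ?case by simp
    qed
  qed (use conn C'_Hom in blast)+
  hence "invertible_intertwiner T2 T1 K' C'"
    unfolding invertible_intertwiner_def using D'_Hom D'C' C'D' by blast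
  thus ?thesis by (rule yb_equivalentI)
qed

section \<open>The equivalence relation and the trace identity\<close>

theorem proposition3p25:
  shows "equiv (symmetric_yb_triples :: ('o, 'a) triple set)
           {(T, T'). T \<in> symmetric_yb_triples \<and> T' \<in> symmetric_yb_triples \<and> yb_equivalent T T'} \<and>
         (\<forall>(T1 :: ('o1, 'a1) triple) (T2 :: ('o2, 'a2) triple)
             (K :: ('o1, 'o2, 'c) lines) (C :: ('a1 \<times> 'c, 'c \<times> 'a2) mat).
            T1 \<in> symmetric_yb_triples \<and> T2 \<in> symmetric_yb_triples \<and>
            invertible_intertwiner T1 T2 K C \<longrightarrow>
            (\<forall>a \<in> Ob (gpd T1). \<forall>b \<in> Ob (gpd T2). \<forall>\<^sub>\<approx>z.
               convolution (space_of T1) K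
                 (partial_trace (space_of T1) (space_of T1) (space_of T1) (rmat T1 z))
                 (partial_trace (space_of T1) K (space_of T2) C) a b =
               convolution K (space_of T2)
                 (partial_trace (space_of T1) K (space_of T2) C)
                 (partial_trace (space_of T2) (space_of T2) (space_of T2) (rmat T2 z)) a b))"
proof (intro conjI equivI allI impI ballI)
  let ?r = "{(T :: ('o, 'a) triple, T'). T \<in> symmetric_yb_triples \<and> T' \<in> symmetric_yb_triples \<and>
    yb_equivalent T T'}"
  show "?r \<subseteq> symmetric_yb_triples \<times> symmetric_yb_triples" by blast
  show "refl_on symmetric_yb_triples ?r"
    by (rule refl_onI) (simp add: yb_equivalent_refl)
  show "sym ?r"
  proof (rule symI)
    fix T T' :: "('o, 'a) triple" assume "(T, T') \<in> ?r"
    hence T: "T \<in> symmetric_yb_triples" "T' \<in> symmetric_yb_triples" and "yb_equivalent T T'"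
      by simp_all
    then obtain K :: "('o, 'o, 'o \<times> 'o \<times> nat) lines" and C where "invertible_intertwiner T T' K C"
      unfolding yb_equivalent_def by (elim exE)
    with T show "(T', T) \<in> ?r" by (simp add: yb_equivalent_dual)
  qed
  show "trans ?r"
  proof (rule transI)
    fix T T' T'' :: "('o, 'a) triple" assume "(T, T') \<in> ?r" "(T', T'') \<in> ?r"
    hence T: "T \<in> symmetric_yb_triples" "T' \<in> symmetric_yb_triples" "T'' \<in> symmetric_yb_triples"
      and "yb_equivalent T T'" "yb_equivalent T' T''"
      by simp_all
    then obtain K L :: "('o, 'o, 'o \<times> 'o \<times> nat) lines" and C C'
      where "invertible_intertwiner T T' K C" "invertible_intertwiner T' T'' L C'"
      unfolding yb_equivalent_def by (elim exE)
    from yb_equivalent_compose[OF T this] T show "(T, T'') \<in> ?r" by simp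
  qed
qed (elim conjE, rule convolution_partial_traces_eq)

end
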